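(* Let $X$ be a symplectic manifold (compact or not). The semi-norms $\{\|\cdot\|_{\hbar,k}\}_{k\ge 0}$ on $C^\infty(X)[[\hbar]]$, given for $f=f_0+\hbar f_1+\hbar^2 f_2+\cdots$ (with $f_i\in C^\infty(X)$) by $$\|f\|_{\hbar,k}:=\sum_{i+j=k}\|f_i\|_j,$$ define a Fréchet topology on $C^\infty(X)[[\hbar]]$, i.e. they make $C^\infty(X)[[\hbar]]$ a Fréchet space.
   Context: Functions are real- or complex-valued (one choice of scalars is fixed); $\hbar$ is a formal variable. Semi-norms on $C^\infty(X)$: fix a countable (possibly finite) covering $X=\bigcup_{i\ge 0}U_i$ by open sets such that each finite union of the $U_i$ has compact closure, with a fixed coordinate system on each $U_i$ (defined on a neighbourhood of the closure $\overline{U_i}$). For $l\ge 0$ and $f\in C^\infty(X)$, $$\|f\|_l:=\sup\Big\{\Big|\frac{\partial^{|I|}f}{\partial x^I}(x_0)\Big| : x_0\in\bigcup_{i\le l}\overline{U_i},\ |I|\le l\Big\},$$ where $I$ is a multi-index, and at a point $x_0\in\overline{U_i}$ ($i\le l$) the partial derivatives are taken in the chosen coordinates of $U_i$ (the supremum is over all such $i$). Fréchet space: a vector space $V$ with a countable family of semi-norms $\{\|\cdot\|_k\}_{k\ge 0}$ such that (i) $\|x\|_k=0$ for all $k$ implies $x=0$, and (ii) every sequence that is Cauchy with respect to each $\|\cdot\|_k$ converges, with respect to each $\|\cdot\|_k$, to some common $x\in V$. Its topology is that of the metric $d(x,y)=\sum_{k\ge 0}2^{-k}\frac{\|x-y\|_k}{1+\|x-y\|_k}$.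 *)

theory Defs
  imports "HOL-Analysis.Analysis" "HOL-Library.Function_Algebras"
begin

section \<open>Partial derivatives on the Euclidean spaces \<open>\<real>\<^sup>m\<close>\<close>

text \<open>
  As in the library's \<^term>\<open>Euclidean_space m\<close>, points of \<open>\<real>\<^sup>m\<close> are functions
  \<open>x :: nat \<Rightarrow> real\<close> that vanish at all indices \<open>\<ge> m\<close>; the coordinates are numbered
  \<open>0, \<dots>, m - 1\<close>.  This allows every dimension, including \<open>m = 0\<close>.
\<close>

definition partial_deriv ::
    "nat \<Rightarrow> ((nat \<Rightarrow> real) \<Rightarrow> 'b::real_normed_vector) \<Rightarrow> (nat \<Rightarrow> real) \<Rightarrow> 'b" where
  "partial_deriv j g x = vector_derivative (\<lambda>t. g (x(j := t))) (at (x j))"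

primrec iter_partial_deriv ::
    "nat list \<Rightarrow> ((nat \<Rightarrow> real) \<Rightarrow> 'b::real_normed_vector) \<Rightarrow> (nat \<Rightarrow> real) \<Rightarrow> 'b" where
  "iter_partial_deriv [] g = g"
| "iter_partial_deriv (j # js) g = partial_deriv j (iter_partial_deriv js g)"

text \<open>
  All partial derivatives of all orders exist and are continuous on \<open>S\<close>, which is meant to be
  open in \<^term>\<open>Euclidean_space m\<close>.  The topology of the type \<^typ>\<open>nat \<Rightarrow> real\<close> is
  the product topology, which induces that of \<^term>\<open>Euclidean_space m\<close>.
\<close>

definition smooth_on ::
    "nat \<Rightarrow> (nat \<Rightarrow> real) set \<Rightarrow> ((nat \<Rightarrow> real) \<Rightarrow> 'b::real_normed_vector) \<Rightarrow> bool" where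
  "smooth_on m S g \<longleftrightarrow>
     (\<forall>js. set js \<subseteq> {..<m} \<longrightarrow>
        continuous_on S (iter_partial_deriv js g) \<and>
        (\<forall>x\<in>S. \<forall>j<m. (\<lambda>t. iter_partial_deriv js g (x(j := t))) differentiable (at (x j))))"

definition multi_indices :: "nat \<Rightarrow> (nat \<Rightarrow> nat) set" where
  "multi_indices m = {I. \<forall>j\<ge>m. I j = 0}"

definition multi_order :: "nat \<Rightarrow> (nat \<Rightarrow> nat) \<Rightarrow> nat" where
  "multi_order m I = (\<Sum>j<m. I j)"

text \<open>The iterated derivative \<open>(\<partial>/\<partial>x\<^sub>0)\<^bsup>I 0\<^esup> \<dots> (\<partial>/\<partial>x\<^sub>m\<^sub>-\<^sub>1)\<^bsup>I (m-1)\<^esup> g\<close>.\<close>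

definition multi_deriv ::
    "nat \<Rightarrow> (nat \<Rightarrow> nat) \<Rightarrow> ((nat \<Rightarrow> real) \<Rightarrow> 'b::real_normed_vector) \<Rightarrow> (nat \<Rightarrow> real) \<Rightarrow> 'b" where
  "multi_deriv m I g = iter_partial_deriv (concat (map (\<lambda>j. replicate (I j) j) [0..<m])) g"


section \<open>Smooth and symplectic manifolds\<close>

text \<open>
  A chart is a pair \<open>(W, \<phi>)\<close> of its domain and its coordinate map; the values of \<open>\<phi>\<close>
  outside \<open>W\<close> are irrelevant.
\<close>

type_synonym 'a chart = "'a set \<times> ('a \<Rightarrow> nat \<Rightarrow> real)"

abbreviation chart_image :: "'a chart \<Rightarrow> (nat \<Rightarrow> real) set" where
  "chart_image c \<equiv> snd c ` fst c"

definition coord_rep :: "'a chart \<Rightarrow> ('a \<Rightarrow> 'b) \<Rightarrow> (nat \<Rightarrow> real) \<Rightarrow> 'b" where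
  "coord_rep c f = f \<circ> inv_into (fst c) (snd c)"

definition is_chart :: "'a topology \<Rightarrow> nat \<Rightarrow> 'a chart \<Rightarrow> bool" where
  "is_chart X m c \<longleftrightarrow>
     openin X (fst c) \<and>
     openin (Euclidean_space m) (chart_image c) \<and>
     homeomorphic_map (subtopology X (fst c))
       (subtopology (Euclidean_space m) (chart_image c)) (snd c)"

definition smooth_transition :: "nat \<Rightarrow> 'a chart \<Rightarrow> 'a chart \<Rightarrow> bool" where
  "smooth_transition m c d \<longleftrightarrow>
     (\<forall>k<m. smooth_on m (snd c ` (fst c \<inter> fst d)) (coord_rep c (\<lambda>p. snd d p k)))"

definition compatible_charts :: "nat \<Rightarrow> 'a chart \<Rightarrow> 'a chart \<Rightarrow> bool" where
  "compatible_charts m c d \<longleftrightarrow> smooth_transition m c d \<and> smooth_transition m d c"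

text \<open>The smooth structure is given by a maximal atlas \<open>A\<close>.\<close>

definition smooth_manifold :: "'a topology \<Rightarrow> nat \<Rightarrow> 'a chart set \<Rightarrow> bool" where
  "smooth_manifold X m A \<longleftrightarrow>
     Hausdorff_space X \<and> second_countable X \<and>
     (\<forall>c\<in>A. is_chart X m c) \<and>
     (\<Union>c\<in>A. fst c) = topspace X \<and>
     (\<forall>c\<in>A. \<forall>d\<in>A. compatible_charts m c d) \<and>
     (\<forall>c. is_chart X m c \<and> (\<forall>d\<in>A. compatible_charts m c d) \<longrightarrow> c \<in> A)"

text \<open>
  A 2-form is given by its components: \<open>\<omega> c i j p\<close> is the coefficient
  \<open>\<omega>\<^sub>p (\<partial>/\<partial>x\<^sub>i, \<partial>/\<partial>x\<^sub>j)\<close> in the coordinates of the chart \<open>c\<close>.  The components in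
  different charts are related by the transformation law of covariant 2-tensors.
\<close>

type_synonym 'a form2 = "'a chart \<Rightarrow> nat \<Rightarrow> nat \<Rightarrow> 'a \<Rightarrow> real"

definition smooth_two_form :: "nat \<Rightarrow> 'a chart set \<Rightarrow> 'a form2 \<Rightarrow> bool" where
  "smooth_two_form m A \<omega> \<longleftrightarrow>
     (\<forall>c\<in>A. \<forall>i<m. \<forall>j<m. smooth_on m (chart_image c) (coord_rep c (\<omega> c i j))) \<and>
     (\<forall>c\<in>A. \<forall>p\<in>fst c. \<forall>i<m. \<forall>j<m. \<omega> c i j p = - \<omega> c j i p) \<and>
     (\<forall>c\<in>A. \<forall>d\<in>A. \<forall>p\<in>fst c \<inter> fst d. \<forall>i<m. \<forall>j<m.
        \<omega> c i j p =
          (\<Sum>k<m. \<Sum>l<m. \<omega> d k l p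
             * partial_deriv i (coord_rep c (\<lambda>q. snd d q k)) (snd c p)
             * partial_deriv j (coord_rep c (\<lambda>q. snd d q l)) (snd c p)))"

definition closed_two_form :: "nat \<Rightarrow> 'a chart set \<Rightarrow> 'a form2 \<Rightarrow> bool" where
  "closed_two_form m A \<omega> \<longleftrightarrow>
     (\<forall>c\<in>A. \<forall>y\<in>chart_image c. \<forall>i<m. \<forall>j<m. \<forall>k<m.
        partial_deriv i (coord_rep c (\<omega> c j k)) y
        + partial_deriv j (coord_rep c (\<omega> c k i)) y
        + partial_deriv k (coord_rep c (\<omega> c i j)) y = 0)"

definition nondegenerate_two_form :: "nat \<Rightarrow> 'a chart set \<Rightarrow> 'a form2 \<Rightarrow> bool" where
  "nondegenerate_two_form m A \<omega> \<longleftrightarrow>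
     (\<forall>c\<in>A. \<forall>p\<in>fst c. \<forall>v :: nat \<Rightarrow> real.
        (\<forall>j<m. (\<Sum>i<m. v i * \<omega> c i j p) = 0) \<longrightarrow> (\<forall>i<m. v i = 0))"

definition symplectic_manifold ::
    "'a topology \<Rightarrow> nat \<Rightarrow> 'a chart set \<Rightarrow> 'a form2 \<Rightarrow> bool" where
  "symplectic_manifold X m A \<omega> \<longleftrightarrow>
     smooth_manifold X m A \<and> smooth_two_form m A \<omega> \<and>
     closed_two_form m A \<omega> \<and> nondegenerate_two_form m A \<omega>"


section \<open>Smooth functions and formal power series of smooth functions\<close>

text \<open>
  A function on \<open>X\<close> is represented by its extension by \<open>0\<close> to the whole type, so that
  equality of functions on \<open>X\<close> is equality in HOL.
\<close>

definition smooth_functions ::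
    "'a topology \<Rightarrow> nat \<Rightarrow> 'a chart set \<Rightarrow> ('a \<Rightarrow> 'k::real_normed_field) set" where
  "smooth_functions X m A =
     {f. (\<forall>x. x \<notin> topspace X \<longrightarrow> f x = 0) \<and>
         (\<forall>c\<in>A. smooth_on m (chart_image c) (coord_rep c f))}"

text \<open>Addition of power series is the library's, with pointwise addition of coefficients.\<close>

definition hbar_series ::
    "'a topology \<Rightarrow> nat \<Rightarrow> 'a chart set \<Rightarrow> ('a \<Rightarrow> 'k::real_normed_field) fps set" where
  "hbar_series X m A = {F. \<forall>i. fps_nth F i \<in> smooth_functions X m A}"

definition hbar_scale :: "'k::real_normed_field \<Rightarrow> ('a \<Rightarrow> 'k) fps \<Rightarrow> ('a \<Rightarrow> 'k) fps" where
  "hbar_scale a F = Abs_fps (\<lambda>i x. a * fps_nth F i x)"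


section \<open>The semi-norms\<close>

text \<open>
  The countable covering is indexed by \<open>J\<close>, which is all of the natural numbers or (finite
  covering) an initial segment.  The coordinate system chosen on \<open>U i\<close> is the chart
  \<open>\<xi> i\<close>, whose domain is an open neighbourhood of the closure of \<open>U i\<close>.
\<close>

definition admissible_covering ::
    "'a topology \<Rightarrow> 'a chart set \<Rightarrow> nat set \<Rightarrow> (nat \<Rightarrow> 'a set) \<Rightarrow> (nat \<Rightarrow> 'a chart) \<Rightarrow> bool" where
  "admissible_covering X A J U \<xi> \<longleftrightarrow>
     (J = UNIV \<or> (\<exists>N. J = {..<N})) \<and>
     (\<forall>i\<in>J. openin X (U i)) \<and>
     (\<Union>i\<in>J. U i) = topspace X \<and>
     (\<forall>K. finite K \<and> K \<subseteq> J \<longrightarrow> compactin X (X closure_of (\<Union>i\<in>K. U i))) \<and>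
     (\<forall>i\<in>J. \<xi> i \<in> A \<and> X closure_of (U i) \<subseteq> fst (\<xi> i))"

text \<open>
  Inserting \<open>0\<close> only matters when the set is empty (the real supremum of the empty set is
  unspecified).
\<close>

definition Cinf_seminorm ::
    "'a topology \<Rightarrow> nat \<Rightarrow> nat set \<Rightarrow> (nat \<Rightarrow> 'a set) \<Rightarrow> (nat \<Rightarrow> 'a chart) \<Rightarrow>
       nat \<Rightarrow> ('a \<Rightarrow> 'k::real_normed_field) \<Rightarrow> real" where
  "Cinf_seminorm X m J U \<xi> l f =
     Sup (insert 0 {norm (multi_deriv m I (coord_rep (\<xi> i) f) (snd (\<xi> i) x)) | i x I.
       i \<in> J \<and> i \<le> l \<and> x \<in> X closure_of (U i) \<and> I \<in> multi_indices m \<and> multi_order m I \<le> l})"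

definition hbar_seminorm ::
    "'a topology \<Rightarrow> nat \<Rightarrow> nat set \<Rightarrow> (nat \<Rightarrow> 'a set) \<Rightarrow> (nat \<Rightarrow> 'a chart) \<Rightarrow>
       nat \<Rightarrow> ('a \<Rightarrow> 'k::real_normed_field) fps \<Rightarrow> real" where
  "hbar_seminorm X m J U \<xi> k F =
     (\<Sum>(i, j) | i + j = k. Cinf_seminorm X m J U \<xi> j (fps_nth F i))"


section \<open>Frechet spaces\<close>

definition seminorm_on ::
    "('k::real_normed_field \<Rightarrow> 'v::ab_group_add \<Rightarrow> 'v) \<Rightarrow> 'v set \<Rightarrow> ('v \<Rightarrow> real) \<Rightarrow> bool" where
  "seminorm_on smul V p \<longleftrightarrow>
     (\<forall>x\<in>V. 0 \<le> p x) \<and>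
     (\<forall>x\<in>V. \<forall>y\<in>V. p (x + y) \<le> p x + p y) \<and>
     (\<forall>a. \<forall>x\<in>V. p (smul a x) = norm a * p x)"

definition frechet_space ::
    "('k::real_normed_field \<Rightarrow> 'v::ab_group_add \<Rightarrow> 'v) \<Rightarrow> 'v set \<Rightarrow> (nat \<Rightarrow> 'v \<Rightarrow> real) \<Rightarrow> bool" where
  "frechet_space smul V p \<longleftrightarrow>
     vector_space smul \<and> module.subspace smul V \<and>
     (\<forall>k. seminorm_on smul V (p k)) \<and>
     (\<forall>x\<in>V. (\<forall>k. p k x = 0) \<longrightarrow> x = 0) \<and>
     (\<forall>s. (\<forall>n. s n \<in> V) \<and>
          (\<forall>k. \<forall>e>0. \<exists>N. \<forall>n\<ge>N. \<forall>n'\<ge>N. p k (s n - s n') < e) \<longrightarrow>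
          (\<exists>x\<in>V. \<forall>k. (\<lambda>n. p k (s n - x)) \<longlonglongrightarrow> 0))"

text \<open>
  The metric that defines the topology of a Frechet space.  Outside \<open>V\<close> it is set to \<open>0\<close>
  because the library's locale \<^locale>\<open>Metric_space\<close> asks for symmetry and nonnegativity on the
  whole type.
\<close>

definition frechet_dist :: "'v::ab_group_add set \<Rightarrow> (nat \<Rightarrow> 'v \<Rightarrow> real) \<Rightarrow> 'v \<Rightarrow> 'v \<Rightarrow> real" where
  "frechet_dist V p x y =
     (if x \<in> V \<and> y \<in> V then \<Sum>k. (1 / 2) ^ k * (p k (x - y) / (1 + p k (x - y))) else 0)"

end

theory Submission
  imports Defs
begin

text \<open>
  A power series is a sequence of coefficients, and each semi-norm of a series is a finite sum of
  semi-norms of coefficients that dominates each of its summands.  Everything therefore reduces to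
  the space of smooth functions on the manifold, where the semi-norm axioms follow from linearity of
  differentiation and from finiteness of the suprema, and where the main point is completeness
  (\<open>smooth_funs_complete\<close>).

  Given a sequence that is Cauchy for all semi-norms, its derivatives of each multi-index order
  are uniformly Cauchy on each \<open>U i\<close> in the chosen coordinates.  Mixed partial derivatives commute
  (\<open>partial_deriv_commute\<close>), so the same holds for derivatives taken in any order, and a
  uniform limit of all derivatives is smooth (\<open>smooth_on_limit\<close>).  Smoothness of the limit in an
  arbitrary chart of the atlas comes from the chain rule, in the form that composites of smooth
  maps are smooth (\<open>smooth_on_compose\<close>), applied to the transition maps.  Finally the bounds that
  hold on \<open>U i\<close> extend to its closure by continuity (\<open>closure_of_bound\<close>), which gives
  convergence in the semi-norms.

  That the usual series defines a metric holds for every Frechet space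
  (\<open>frechet_space_imp_Metric_space\<close>).
\<close>

section \<open>Partial derivatives and smooth functions on open subsets of Euclidean space\<close>

text \<open>
  The counterpart of \<^const>\<open>partial_deriv\<close> that carries existence: a vector derivative
  that does not exist still has some value.
\<close>

definition has_partial ::
    "((nat \<Rightarrow> real) \<Rightarrow> 'b::real_normed_vector) \<Rightarrow> nat \<Rightarrow> 'b \<Rightarrow> (nat \<Rightarrow> real) \<Rightarrow> bool" where
  "has_partial g j D x \<longleftrightarrow> ((\<lambda>t. g (x(j := t))) has_vector_derivative D) (at (x j))"

lemma has_partial_imp_partial_deriv: "has_partial g j D x \<Longrightarrow> partial_deriv j g x = D"
  unfolding has_partial_def partial_deriv_def by (rule vector_derivative_at)

lemma has_partial_iff_differentiable:
  "(\<lambda>t. g (x(j := t))) differentiable (at (x j)) \<longleftrightarrow> has_partial g j (partial_deriv j g x) x"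
  unfolding has_partial_def partial_deriv_def
  using differentiableI_vector vector_derivative_works by blast

lemma has_partial_slice:
  "has_partial g j D (x(j := s)) \<longleftrightarrow> ((\<lambda>t. g (x(j := t))) has_vector_derivative D) (at s)"
  unfolding has_partial_def by simp

lemma subtopology_Euclidean_space:
  assumes "S \<subseteq> topspace (Euclidean_space m)"
  shows "subtopology (Euclidean_space m) S = top_of_set S"
  using assms unfolding Euclidean_space_def
  by (simp add: subtopology_subtopology euclidean_product_topology Int_absorb1)

lemma Euclidean_space_vanish:
  assumes "openin (Euclidean_space m) S" "x \<in> S" "m \<le> k"
  shows "x k = 0"
  using openin_subset[OF assms(1)] assms(2,3) by (auto simp: topspace_Euclidean_space)

text \<open>
  The product topology restricts only finitely many coordinates, and beyond \<open>m\<close> all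
  coordinates are \<open>0\<close>; hence open sets contain boxes of one common width \<open>d\<close>.
\<close>

lemma openin_Euclidean_space_box:
  assumes "openin (Euclidean_space m) S" "x \<in> S"
  obtains d where "d > 0"
    "\<And>y. (\<And>k. k < m \<Longrightarrow> \<bar>y k - x k\<bar> < d) \<Longrightarrow> (\<And>k. m \<le> k \<Longrightarrow> y k = 0) \<Longrightarrow> y \<in> S"
proof -
  obtain T where T: "openin (powertop_real UNIV) T" "S = T \<inter> {x. \<forall>i\<ge>m. x i = 0}"
    using assms(1) unfolding Euclidean_space_def openin_subtopology by auto
  with assms(2) obtain Y where Y: "x \<in> (\<Pi>\<^sub>E i\<in>UNIV. Y i)" "\<And>i. open (Y i)" "(\<Pi>\<^sub>E i\<in>UNIV. Y i) \<subseteq> T"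
    using product_topology_open_contains_basis[OF T(1), of x] by auto
  have "\<exists>e>0. \<forall>t. \<bar>t - x k\<bar> < e \<longrightarrow> t \<in> Y k" for k
    using Y(1) Y(2)[of k] by (auto simp: open_dist dist_real_def)
  then obtain e where e: "\<And>k. e k > 0" "\<And>k t. \<bar>t - x k\<bar> < e k \<Longrightarrow> t \<in> Y k"
    by metis
  \<comment> \<open>The \<open>1\<close> keeps the minimum meaningful for \<open>m = 0\<close>.\<close>
  define d where "d = Min (insert 1 (e ` {..<m}))"
  have "d > 0" unfolding d_def using e(1) by (subst Min_gr_iff) auto
  moreover have "y \<in> S" if y: "\<And>k. k < m \<Longrightarrow> \<bar>y k - x k\<bar> < d" "\<And>k. m \<le> k \<Longrightarrow> y k = 0" for y
  proof -
    have "y k \<in> Y k" for k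
    proof (cases "k < m")
      case True
      then have "d \<le> e k" unfolding d_def by (intro Min_le) auto
      with y(1)[OF True] show ?thesis by (intro e(2)) auto
    next
      case False
      then have "y k = x k" using y(2) Euclidean_space_vanish[OF assms] by simp
      then show ?thesis using Y(1) by auto
    qed
    then show ?thesis using T(2) Y(3) y(2) by auto
  qed
  ultimately show ?thesis using that by blast
qed

text \<open>
  The form in which continuity enters estimates: boxes take the place of balls, and the condition
  \<open>y k = 0\<close> for \<open>k \<ge> m\<close> keeps \<open>y\<close> in Euclidean space.
\<close>

lemma openin_Euclidean_space_near:
  assumes "openin (Euclidean_space m) S" "x \<in> S" "continuous_on S g" "e > (0::real)"
  obtains d where "d > 0"
    "\<And>y. (\<And>k. k < m \<Longrightarrow> \<bar>y k - x k\<bar> < d) \<Longrightarrow> (\<And>k. m \<le> k \<Longrightarrow> y k = 0) \<Longrightarrow> y \<in> S \<and> dist (g y) (g x) < e"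
proof -
  have "openin (top_of_set S) (S \<inter> g -` ball (g x) e)"
    using continuous_openin_preimage_gen[OF assms(3) open_ball] .
  then have "openin (Euclidean_space m) (S \<inter> g -` ball (g x) e)"
    using assms(1) openin_subset[OF assms(1)]
    by (metis openin_trans_full subtopology_Euclidean_space)
  then obtain d where "d > 0"
    "\<And>y. (\<And>k. k < m \<Longrightarrow> \<bar>y k - x k\<bar> < d) \<Longrightarrow> (\<And>k. m \<le> k \<Longrightarrow> y k = 0) \<Longrightarrow> y \<in> S \<inter> g -` ball (g x) e"
    using assms(2,4) by (elim openin_Euclidean_space_box[where x = x]) auto
  then show ?thesis using that[of d] by (auto simp: dist_commute)
qed

lemma openin_Euclidean_space_slice:
  assumes "openin (Euclidean_space m) S" "x \<in> S" "j < m"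
  obtains d where "d > 0" "\<And>t. \<bar>t - x j\<bar> < d \<Longrightarrow> x(j := t) \<in> S"
proof -
  obtain d where d: "d > 0"
    "\<And>y. (\<And>k. k < m \<Longrightarrow> \<bar>y k - x k\<bar> < d) \<Longrightarrow> (\<And>k. m \<le> k \<Longrightarrow> y k = 0) \<Longrightarrow> y \<in> S"
    using openin_Euclidean_space_box[OF assms(1,2)] by blast
  have "x(j := t) \<in> S" if "\<bar>t - x j\<bar> < d" for t
    using that d(1) assms(3) Euclidean_space_vanish[OF assms(1,2)] by (intro d(2)) auto
  with d(1) show ?thesis using that by blast
qed

lemma continuous_on_open_cover:
  assumes "\<And>x. x \<in> S \<Longrightarrow> \<exists>R. openin (Euclidean_space m) R \<and> x \<in> R \<and> R \<subseteq> S \<and> continuous_on R g"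
    and "S \<subseteq> topspace (Euclidean_space m)"
  shows "continuous_on S g"
  unfolding continuous_on_def
proof
  fix x assume "x \<in> S"
  then obtain R where R: "openin (Euclidean_space m) R" "x \<in> R" "R \<subseteq> S" "continuous_on R g"
    using assms(1) by blast
  then have "openin (top_of_set S) R"
    using assms(2) by (metis openin_subtopology_Int2 subtopology_Euclidean_space inf.absorb_iff2)
  then obtain T where T: "open T" "R = S \<inter> T" by (auto simp: openin_open)
  have "at x within S = at x within R"
    by (rule at_within_nhd[of x T]) (use R(2) T in auto)
  then show "(g \<longlongrightarrow> g x) (at x within S)"
    using R(2,4) by (simp add: continuous_on_def)
qed

lemma has_partial_cong:
  assumes "openin (Euclidean_space m) S" "x \<in> S" "j < m" "\<And>y. y \<in> S \<Longrightarrow> g y = h y"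
  shows "has_partial g j D x \<longleftrightarrow> has_partial h j D x"
proof -
  obtain d where d: "d > 0" "\<And>t. \<bar>t - x j\<bar> < d \<Longrightarrow> x(j := t) \<in> S"
    using openin_Euclidean_space_slice[OF assms(1-3)] by blast
  have "\<forall>\<^sub>F t in nhds (x j). g (x(j := t)) = h (x(j := t))"
    unfolding eventually_nhds_metric using d assms(4) by (auto simp: dist_real_def)
  then show ?thesis
    unfolding has_partial_def by (intro has_vector_derivative_cong_ev) (use assms(2,4) in auto)
qed

lemma partial_deriv_cong:
  assumes "openin (Euclidean_space m) S" "x \<in> S" "j < m" "\<And>y. y \<in> S \<Longrightarrow> g y = h y"
  shows "partial_deriv j g x = partial_deriv j h x"
  using has_partial_cong[OF assms(1-3), of g h] assms(4)
  unfolding partial_deriv_def vector_derivative_def has_partial_def by presburger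

lemma iter_partial_deriv_append:
  "iter_partial_deriv (ks @ js) g = iter_partial_deriv ks (iter_partial_deriv js g)"
  by (induction ks) auto

text \<open>
  Iterated derivatives grow by an outermost derivative.  Splitting off the innermost one instead
  reduces smoothness of \<open>g\<close> to smoothness of its partial derivatives, which is the step that
  inductions over smooth functions need.
\<close>

lemma smooth_on_unfold:
  "smooth_on m S g \<longleftrightarrow> continuous_on S g \<and>
     (\<forall>j<m. (\<forall>x\<in>S. has_partial g j (partial_deriv j g x) x) \<and> smooth_on m S (partial_deriv j g))"
proof
  assume g: "smooth_on m S g"
  have "smooth_on m S (partial_deriv j g)" if "j < m" for j
  proof -
    have "continuous_on S (iter_partial_deriv (js @ [j]) g) \<and>
       (\<forall>x\<in>S. \<forall>i<m. (\<lambda>t. iter_partial_deriv (js @ [j]) g (x(i := t))) differentiable (at (x i)))"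
      if "set js \<subseteq> {..<m}" for js
      using g[unfolded smooth_on_def, rule_format, of "js @ [j]"] that \<open>j < m\<close> by simp
    then show ?thesis unfolding smooth_on_def by (simp add: iter_partial_deriv_append)
  qed
  moreover have "continuous_on S g \<and> (\<forall>x\<in>S. \<forall>j<m. has_partial g j (partial_deriv j g x) x)"
    using g unfolding smooth_on_def has_partial_iff_differentiable by (auto dest: spec[of _ "[]"])
  ultimately show "continuous_on S g \<and>
     (\<forall>j<m. (\<forall>x\<in>S. has_partial g j (partial_deriv j g x) x) \<and> smooth_on m S (partial_deriv j g))"
    by blast
next
  assume g: "continuous_on S g \<and>
     (\<forall>j<m. (\<forall>x\<in>S. has_partial g j (partial_deriv j g x) x) \<and> smooth_on m S (partial_deriv j g))"
  show "smooth_on m S g" unfolding smooth_on_def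
  proof (intro allI impI)
    fix js :: "nat list" assume js: "set js \<subseteq> {..<m}"
    show "continuous_on S (iter_partial_deriv js g) \<and>
       (\<forall>x\<in>S. \<forall>j<m. (\<lambda>t. iter_partial_deriv js g (x(j := t))) differentiable (at (x j)))"
    proof (cases js rule: rev_cases)
      case Nil
      then show ?thesis using g by (simp add: has_partial_iff_differentiable)
    next
      case (snoc ks j)
      then show ?thesis using g js unfolding smooth_on_def
        by (auto simp: iter_partial_deriv_append)
    qed
  qed
qed

lemma smooth_on_iter:
  assumes "smooth_on m S g" "set js \<subseteq> {..<m}"
  shows "smooth_on m S (iter_partial_deriv js g)"
  using assms(2)
proof (induction js)
  case (Cons j js)
  then show ?case using smooth_on_unfold[of m S "iter_partial_deriv js g"] by auto
qed (use assms(1) in auto)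

lemma smooth_on_continuous: "smooth_on m S g \<Longrightarrow> continuous_on S g"
  by (simp add: smooth_on_unfold[of m S g])

lemma smooth_on_has_partial:
  "smooth_on m S g \<Longrightarrow> j < m \<Longrightarrow> x \<in> S \<Longrightarrow> has_partial g j (partial_deriv j g x) x"
  by (simp add: smooth_on_unfold[of m S g])

lemma smooth_on_partial_deriv: "smooth_on m S g \<Longrightarrow> j < m \<Longrightarrow> smooth_on m S (partial_deriv j g)"
  by (simp add: smooth_on_unfold[of m S g])

lemma smooth_on_open_cover:
  assumes "\<And>x. x \<in> S \<Longrightarrow> \<exists>R. openin (Euclidean_space m) R \<and> x \<in> R \<and> R \<subseteq> S \<and> smooth_on m R g"
    and "S \<subseteq> topspace (Euclidean_space m)"
  shows "smooth_on m S g"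
  unfolding smooth_on_def
proof (intro allI impI conjI ballI)
  fix js :: "nat list" assume js: "set js \<subseteq> {..<m}"
  show "continuous_on S (iter_partial_deriv js g)"
  proof (rule continuous_on_open_cover[OF _ assms(2)])
    fix x assume "x \<in> S"
    then obtain R where "openin (Euclidean_space m) R" "x \<in> R" "R \<subseteq> S" "smooth_on m R g"
      using assms(1) by blast
    then show "\<exists>R. openin (Euclidean_space m) R \<and> x \<in> R \<and> R \<subseteq> S \<and>
        continuous_on R (iter_partial_deriv js g)"
      using js unfolding smooth_on_def by blast
  qed
  fix x j assume "x \<in> S" "j < m"
  then obtain R where "x \<in> R" "smooth_on m R g" using assms(1) by blast
  with js \<open>j < m\<close> show "(\<lambda>t. iter_partial_deriv js g (x(j := t))) differentiable (at (x j))"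
    unfolding smooth_on_def by blast
qed

lemma has_partial_lincomb:
  fixes f g :: "(nat \<Rightarrow> real) \<Rightarrow> 'k::real_normed_field"
  assumes "has_partial f j D x" "has_partial g j E x"
  shows "has_partial (\<lambda>y. a * f y + b * g y) j (a * D + b * E) x"
  using assms unfolding has_partial_def
  by (intro has_vector_derivative_add has_vector_derivative_mult_right)

lemma iter_partial_deriv_lincomb:
  fixes f g :: "(nat \<Rightarrow> real) \<Rightarrow> 'k::real_normed_field"
  assumes S: "openin (Euclidean_space m) S" and f: "smooth_on m S f" and g: "smooth_on m S g"
    and js: "set js \<subseteq> {..<m}" and "x \<in> S"
  shows "iter_partial_deriv js (\<lambda>y. a * f y + b * g y) x =
    a * iter_partial_deriv js f x + b * iter_partial_deriv js g x"
  using js \<open>x \<in> S\<close>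
proof (induction js arbitrary: x)
  case (Cons j js)
  then have "iter_partial_deriv (j # js) (\<lambda>y. a * f y + b * g y) x =
    partial_deriv j (\<lambda>y. a * iter_partial_deriv js f y + b * iter_partial_deriv js g y) x"
    by (simp, intro partial_deriv_cong[OF S]) auto
  also have "\<dots> = a * iter_partial_deriv (j # js) f x + b * iter_partial_deriv (j # js) g x"
    unfolding iter_partial_deriv.simps
    by (intro has_partial_imp_partial_deriv has_partial_lincomb
        smooth_on_has_partial[OF smooth_on_iter[OF f]] smooth_on_has_partial[OF smooth_on_iter[OF g]])
      (use Cons.prems in auto)
  finally show ?case .
qed simp

lemma smooth_on_lincomb:
  fixes f g :: "(nat \<Rightarrow> real) \<Rightarrow> 'k::real_normed_field"
  assumes S: "openin (Euclidean_space m) S" and f: "smooth_on m S f" and g: "smooth_on m S g"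
  shows "smooth_on m S (\<lambda>y. a * f y + b * g y)"
  unfolding smooth_on_def has_partial_iff_differentiable
proof (intro allI impI conjI ballI)
  fix js :: "nat list" assume js: "set js \<subseteq> {..<m}"
  note eq = iter_partial_deriv_lincomb[OF S f g js, of _ a b]
  have F: "smooth_on m S (iter_partial_deriv js f)" "smooth_on m S (iter_partial_deriv js g)"
    using f g js by (auto intro: smooth_on_iter)
  show "continuous_on S (iter_partial_deriv js (\<lambda>y. a * f y + b * g y))"
    using smooth_on_continuous[OF F(1)] smooth_on_continuous[OF F(2)]
    by (subst continuous_on_cong[OF refl eq]) (auto intro!: continuous_on_add continuous_on_mult_left)
  fix x j assume xj: "x \<in> S" "j < m"
  have "has_partial (\<lambda>y. a * iter_partial_deriv js f y + b * iter_partial_deriv js g y) j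
     (a * partial_deriv j (iter_partial_deriv js f) x + b * partial_deriv j (iter_partial_deriv js g) x) x"
    by (intro has_partial_lincomb smooth_on_has_partial[OF F(1)] smooth_on_has_partial[OF F(2)] xj)
  then have "has_partial (iter_partial_deriv js (\<lambda>y. a * f y + b * g y)) j
     (a * partial_deriv j (iter_partial_deriv js f) x + b * partial_deriv j (iter_partial_deriv js g) x) x"
    by (subst has_partial_cong[OF S xj eq])
  then show "has_partial (iter_partial_deriv js (\<lambda>y. a * f y + b * g y)) j
      (partial_deriv j (iter_partial_deriv js (\<lambda>y. a * f y + b * g y)) x) x"
    using has_partial_imp_partial_deriv by metis
qed

section \<open>Symmetry of mixed partial derivatives\<close>

lemma has_vector_derivative_id_scaleR: "((\<lambda>t. t *\<^sub>R L) has_vector_derivative L) F"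
  unfolding has_vector_derivative_def
  by (intro bounded_linear_imp_has_derivative bounded_linear_scaleR_left)

text \<open>
  The mean value inequality for \<open>\<phi> t - t *\<^sub>R L\<close>.  It replaces the mean value theorem,
  which fails for vector-valued functions.
\<close>

lemma norm_increment_bound:
  fixes \<phi> :: "real \<Rightarrow> 'b::real_normed_vector"
  assumes "\<And>t. t \<in> closed_segment a b \<Longrightarrow> (\<phi> has_vector_derivative \<phi>' t) (at t)"
    and "\<And>t. t \<in> closed_segment a b \<Longrightarrow> norm (\<phi>' t - L) \<le> B"
  shows "norm (\<phi> b - \<phi> a - (b - a) *\<^sub>R L) \<le> \<bar>b - a\<bar> * B"
proof -
  have "norm ((\<phi> b - b *\<^sub>R L) - (\<phi> a - a *\<^sub>R L)) \<le> B * norm (b - a)"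
  proof (rule differentiable_bound[where f = "\<lambda>t. \<phi> t - t *\<^sub>R L" and S = "closed_segment a b"])
    fix t assume t: "t \<in> closed_segment a b"
    show "((\<lambda>t. \<phi> t - t *\<^sub>R L) has_derivative (\<lambda>h. h *\<^sub>R (\<phi>' t - L))) (at t within closed_segment a b)"
      unfolding has_vector_derivative_def[symmetric]
      by (rule has_vector_derivative_at_within)
        (intro has_vector_derivative_diff[OF assms(1)[OF t]]
          has_vector_derivative_id_scaleR)
    show "onorm (\<lambda>h. h *\<^sub>R (\<phi>' t - L)) \<le> B"
      by (rule onorm_le) (use mult_left_mono[OF assms(2)[OF t] abs_ge_zero] in \<open>simp add: mult.commute[of B]\<close>)
  qed auto
  then show ?thesis by (simp add: algebra_simps)
qed

text \<open>
  The mixed second difference over a square of side \<open>h\<close> is an increment in \<open>x\<^sub>j\<close> of an increment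
  in \<open>x\<^sub>k\<close>, so two applications of the mean value inequality compare it with
  \<open>h\<^sup>2\<close> times the mixed derivative taken in this order.
\<close>

lemma second_difference_quotient:
  assumes S: "openin (Euclidean_space m) S" and g: "smooth_on m S g" and "x \<in> S"
    and jk: "j < m" "k < m" "j \<noteq> k" and "e > 0"
  obtains d where "d > 0"
    "\<And>h. 0 < h \<Longrightarrow> h < d \<Longrightarrow>
      norm (g (x(j := x j + h, k := x k + h)) - g (x(k := x k + h)) - (g (x(j := x j + h)) - g x)
        - (h * h) *\<^sub>R partial_deriv k (partial_deriv j g) x) \<le> h * h * e"
proof -
  define P where "P = partial_deriv k (partial_deriv j g)"
  have gj: "smooth_on m S (partial_deriv j g)" using g jk(1) by (rule smooth_on_partial_deriv)
  then have "continuous_on S P"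
    unfolding P_def using smooth_on_partial_deriv[OF gj jk(2)] by (intro smooth_on_continuous)
  from openin_Euclidean_space_near[OF S \<open>x \<in> S\<close> this \<open>e > 0\<close>]
  obtain d where d: "d > 0"
    "\<And>y. (\<And>i. i < m \<Longrightarrow> \<bar>y i - x i\<bar> < d) \<Longrightarrow> (\<And>i. m \<le> i \<Longrightarrow> y i = 0) \<Longrightarrow> y \<in> S \<and> dist (P y) (P x) < e"
    by blast
  have "norm (g (x(j := x j + h, k := x k + h)) - g (x(k := x k + h)) - (g (x(j := x j + h)) - g x)
        - (h * h) *\<^sub>R P x) \<le> h * h * e" if h: "0 < h" "h < d" for h
  proof -
    define F where "F s t = x(j := s, k := t)" for s t
    have F: "F s t \<in> S" "norm (P (F s t) - P x) \<le> e"
      if "s \<in> closed_segment (x j) (x j + h)" "t \<in> closed_segment (x k) (x k + h)" for s t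
    proof -
      have "F s t \<in> S \<and> dist (P (F s t)) (P x) < e"
        using that h jk d(1) Euclidean_space_vanish[OF S \<open>x \<in> S\<close>]
        by (intro d(2)) (auto simp: F_def closed_segment_eq_real_ivl)
      then show "F s t \<in> S" "norm (P (F s t) - P x) \<le> e" by (auto simp: dist_norm)
    qed
    have ds: "((\<lambda>s. g (F s t)) has_vector_derivative partial_deriv j g (F s t)) (at s)"
      if "F s t \<in> S" for s t
    proof -
      have "F s t j = s" "(F s t)(j := r) = F r t" for r
        using jk(3) by (auto simp: F_def)
      with smooth_on_has_partial[OF g jk(1) that] show ?thesis by (simp add: has_partial_def)
    qed
    have dt: "((\<lambda>t. partial_deriv j g (F s t)) has_vector_derivative P (F s t)) (at t)"
      if "F s t \<in> S" for s t
    proof -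
      have "F s t k = t" "(F s t)(k := r) = F s r" for r by (auto simp: F_def)
      with smooth_on_has_partial[OF gj jk(2) that] show ?thesis by (simp add: has_partial_def P_def)
    qed
    \<comment> \<open>The derivative of \<open>\<phi>\<close> is an increment of \<open>\<partial>g/\<partial>x\<^sub>j\<close> in direction \<open>k\<close>, hence close to
      \<open>h *\<^sub>R P x\<close>.\<close>
    define \<phi> where "\<phi> s = g (F s (x k + h)) - g (F s (x k))" for s
    have "norm (\<phi> (x j + h) - \<phi> (x j) - (x j + h - x j) *\<^sub>R (h *\<^sub>R P x)) \<le> \<bar>x j + h - x j\<bar> * (h * e)"
    proof (rule norm_increment_bound)
      fix s assume s: "s \<in> closed_segment (x j) (x j + h)"
      show "(\<phi> has_vector_derivative
          partial_deriv j g (F s (x k + h)) - partial_deriv j g (F s (x k))) (at s)"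
        unfolding \<phi>_def by (intro has_vector_derivative_diff ds F s) auto
      have "norm (partial_deriv j g (F s (x k + h)) - partial_deriv j g (F s (x k))
          - (x k + h - x k) *\<^sub>R P x) \<le> \<bar>x k + h - x k\<bar> * e"
        by (rule norm_increment_bound[where \<phi> = "\<lambda>t. partial_deriv j g (F s t)" and \<phi>' = "\<lambda>t. P (F s t)"])
          (intro dt F s, assumption)+
      then show "norm (partial_deriv j g (F s (x k + h)) - partial_deriv j g (F s (x k))
          - h *\<^sub>R P x) \<le> h * e" using h by simp
    qed
    moreover have "F (x j) t = x(k := t)" "F s (x k) = x(j := s)" for s t
      using jk(3) by (auto simp: F_def)
    then have "g (x(j := x j + h, k := x k + h)) - g (x(k := x k + h)) - (g (x(j := x j + h)) - g x)
        = \<phi> (x j + h) - \<phi> (x j)"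
      unfolding \<phi>_def by (simp add: F_def)
    ultimately show ?thesis using h by (simp add: mult.assoc)
  qed
  with d(1) show ?thesis using that unfolding P_def by blast
qed

text \<open>
  The mixed second difference does not change when \<open>j\<close> and \<open>k\<close> are exchanged, and divided
  by \<open>h\<^sup>2\<close> it approximates both mixed derivatives.
\<close>

lemma partial_deriv_commute:
  assumes S: "openin (Euclidean_space m) S" and g: "smooth_on m S g" and "x \<in> S"
    and jk: "j < m" "k < m"
  shows "partial_deriv j (partial_deriv k g) x = partial_deriv k (partial_deriv j g) x"
proof (cases "j = k")
  case False
  let ?P = "partial_deriv j (partial_deriv k g) x" and ?Q = "partial_deriv k (partial_deriv j g) x"
  have "norm (?P - ?Q) \<le> 0 + r" if "r > 0" for r
  proof -
    define e where "e = r / 2"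
    then have "e > 0" using that by simp
    obtain d where d: "d > 0" "\<And>h. 0 < h \<Longrightarrow> h < d \<Longrightarrow>
      norm (g (x(j := x j + h, k := x k + h)) - g (x(k := x k + h)) - (g (x(j := x j + h)) - g x)
        - (h * h) *\<^sub>R ?Q) \<le> h * h * e"
      using second_difference_quotient[OF S g \<open>x \<in> S\<close> jk False \<open>e > 0\<close>] by blast
    obtain d' where d': "d' > 0" "\<And>h. 0 < h \<Longrightarrow> h < d' \<Longrightarrow>
      norm (g (x(k := x k + h, j := x j + h)) - g (x(j := x j + h)) - (g (x(k := x k + h)) - g x)
        - (h * h) *\<^sub>R ?P) \<le> h * h * e"
      using second_difference_quotient[OF S g \<open>x \<in> S\<close> jk(2,1) False[symmetric] \<open>e > 0\<close>] by blast
    define h where "h = min d d' / 2"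
    have h: "0 < h" "h < d" "h < d'" using d(1) d'(1) by (auto simp: h_def min_def)
    define \<Delta> where "\<Delta> = g (x(j := x j + h, k := x k + h)) - g (x(k := x k + h)) - (g (x(j := x j + h)) - g x)"
    have "norm (\<Delta> - (h * h) *\<^sub>R ?Q) \<le> h * h * e" using d(2) h unfolding \<Delta>_def by blast
    moreover have "norm (\<Delta> - (h * h) *\<^sub>R ?P) \<le> h * h * e"
      using d'(2)[OF h(1,3)] unfolding \<Delta>_def fun_upd_twist[OF False] by (simp add: algebra_simps)
    ultimately have "norm ((\<Delta> - (h * h) *\<^sub>R ?Q) - (\<Delta> - (h * h) *\<^sub>R ?P)) \<le> h * h * e + h * h * e"
      by (rule order_trans[OF norm_triangle_ineq4 add_mono])
    then have "norm ((h * h) *\<^sub>R (?P - ?Q)) \<le> (h * h) * (2 * e)"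
      by (simp add: algebra_simps)
    then show ?thesis using h by (simp add: e_def)
  qed
  then have "norm (?P - ?Q) \<le> 0" by (rule field_le_epsilon)
  then show ?thesis by simp
qed simp

text \<open>
  Insertion moves \<open>j\<close> inwards by exchanging adjacent derivatives.
\<close>

lemma iter_partial_deriv_insort:
  assumes S: "openin (Euclidean_space m) S" and g: "smooth_on m S g"
  shows "set (j # js) \<subseteq> {..<m} \<Longrightarrow> x \<in> S \<Longrightarrow>
    iter_partial_deriv (insort j js) g x = iter_partial_deriv (j # js) g x"
proof (induction js arbitrary: x)
  case (Cons k js)
  show ?case
  proof (cases "j \<le> k")
    case False
    have "iter_partial_deriv (insort j (k # js)) g x = partial_deriv k (iter_partial_deriv (insort j js) g) x"
      using False by simp
    also have "\<dots> = partial_deriv k (iter_partial_deriv (j # js) g) x"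
      using Cons by (intro partial_deriv_cong[OF S]) auto
    also have "\<dots> = partial_deriv j (partial_deriv k (iter_partial_deriv js g)) x"
      using Cons.prems unfolding iter_partial_deriv.simps
      by (intro partial_deriv_commute[OF S] smooth_on_iter[OF g]) auto
    finally show ?thesis by simp
  qed simp
qed simp

lemma iter_partial_deriv_sort:
  assumes S: "openin (Euclidean_space m) S" and g: "smooth_on m S g"
  shows "set js \<subseteq> {..<m} \<Longrightarrow> x \<in> S \<Longrightarrow> iter_partial_deriv (sort js) g x = iter_partial_deriv js g x"
proof (induction js arbitrary: x)
  case (Cons j js)
  have "iter_partial_deriv (sort (j # js)) g x = iter_partial_deriv (j # sort js) g x"
    using Cons.prems by (simp del: iter_partial_deriv.simps)
      (intro iter_partial_deriv_insort[OF S g], auto)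
  also have "\<dots> = iter_partial_deriv (j # js) g x"
    using Cons unfolding iter_partial_deriv.simps by (intro partial_deriv_cong[OF S]) auto
  finally show ?case .
qed simp

text \<open>
  Semi-norms see only derivatives in the fixed order of \<^const>\<open>multi_deriv\<close>, whereas
  smoothness asks for derivatives in every order; this lemma bridges the two.
\<close>

lemma iter_partial_deriv_eq_multi_deriv:
  assumes S: "openin (Euclidean_space m) S" and g: "smooth_on m S g"
    and js: "set js \<subseteq> {..<m}" and "x \<in> S"
  shows "iter_partial_deriv js g x = multi_deriv m (count_list js) g x"
proof -
  let ?ks = "concat (map (\<lambda>j. replicate (count_list js j) j) [0..<m])"
  have count: "count_list (concat (map (\<lambda>j. replicate (I j) j) [0..<n])) i = (if i < n then I i else 0)"
    for I :: "nat \<Rightarrow> nat" and n i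
  proof (induction n)
    case (Suc n)
    have "count_list (replicate r n) i = (if n = i then r else 0)" for r by (induction r) auto
    with Suc show ?case by (auto simp: less_Suc_eq)
  qed simp
  have "sorted (concat (map (\<lambda>j. replicate (I j) j) [0..<n]))" for I :: "nat \<Rightarrow> nat" and n
    by (induction n) (auto simp: sorted_append)
  moreover have "mset ?ks = mset js"
  proof (rule multiset_eqI)
    fix i
    have "count_list js i = 0" if "\<not> i < m" using js that by (auto simp: count_list_0_iff)
    then show "count (mset ?ks) i = count (mset js) i"
      using count[of "count_list js" m i] by (simp add: count_mset)
  qed
  ultimately have "sort js = ?ks" by (intro properties_for_sort) auto
  then show ?thesis
    using iter_partial_deriv_sort[OF S g js \<open>x \<in> S\<close>] unfolding multi_deriv_def by simp
qed

section \<open>The chain rule\<close>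

text \<open>
  Pass from \<open>x\<close> to \<open>y\<close> by changing one coordinate at a time; each step is controlled by the mean
  value inequality and the continuity of one partial derivative.
\<close>

lemma linear_approximation:
  assumes S: "openin (Euclidean_space m) S" and g: "smooth_on m S g" and "x \<in> S" and "e > 0"
  obtains d where "d > 0"
    "\<And>y. (\<And>k. k < m \<Longrightarrow> \<bar>y k - x k\<bar> < d) \<Longrightarrow> (\<And>k. m \<le> k \<Longrightarrow> y k = 0) \<Longrightarrow>
      norm (g y - g x - (\<Sum>k<m. (y k - x k) *\<^sub>R partial_deriv k g x)) \<le> (\<Sum>k<m. \<bar>y k - x k\<bar> * e)"
proof -
  have "\<exists>d>0. \<forall>y. (\<forall>k<m. \<bar>y k - x k\<bar> < d) \<longrightarrow> (\<forall>k\<ge>m. y k = 0) \<longrightarrow>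
      y \<in> S \<and> dist (partial_deriv i g y) (partial_deriv i g x) < e" if "i < m" for i
    by (rule openin_Euclidean_space_near[OF S \<open>x \<in> S\<close>
          smooth_on_continuous[OF smooth_on_partial_deriv[OF g that]] \<open>e > 0\<close>]) blast
  then obtain c where c: "\<And>i. i < m \<Longrightarrow> c i > 0"
    "\<And>i y. i < m \<Longrightarrow> (\<And>k. k < m \<Longrightarrow> \<bar>y k - x k\<bar> < c i) \<Longrightarrow> (\<And>k. m \<le> k \<Longrightarrow> y k = 0) \<Longrightarrow>
      y \<in> S \<and> dist (partial_deriv i g y) (partial_deriv i g x) < e"
    by metis
  \<comment> \<open>The \<open>1\<close> keeps the minimum meaningful for \<open>m = 0\<close>.\<close>
  define d where "d = Min (insert 1 (c ` {..<m}))"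
  have "d > 0" unfolding d_def using c(1) by (subst Min_gr_iff) auto
  have dc: "d \<le> c i" if "i < m" for i unfolding d_def using that by (intro Min_le) auto
  have "norm (g y - g x - (\<Sum>k<m. (y k - x k) *\<^sub>R partial_deriv k g x)) \<le> (\<Sum>k<m. \<bar>y k - x k\<bar> * e)"
    if y: "\<And>k. k < m \<Longrightarrow> \<bar>y k - x k\<bar> < d" "\<And>k. m \<le> k \<Longrightarrow> y k = 0" for y
  proof -
    define z where "z n = (\<lambda>i. if i < n then y i else x i)" for n
    have x0: "x k = 0" if "m \<le> k" for k using Euclidean_space_vanish[OF S \<open>x \<in> S\<close> that] .
    have "z 0 = x" by (auto simp: z_def)
    have "z m = y" using x0 y(2) by (force simp: z_def)
    have step: "norm (g (z (Suc n)) - g (z n) - (y n - x n) *\<^sub>R partial_deriv n g x) \<le> \<bar>y n - x n\<bar> * e"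
      if "n < m" for n
    proof -
      have zt: "(z n)(n := t) \<in> S \<and> dist (partial_deriv n g ((z n)(n := t))) (partial_deriv n g x) < e"
        if "t \<in> closed_segment (x n) (y n)" for t
      proof (rule c(2)[OF \<open>n < m\<close>])
        fix k assume "k < m"
        have "\<bar>t - x n\<bar> \<le> \<bar>y n - x n\<bar>"
          using that by (auto simp: closed_segment_eq_real_ivl split: if_splits)
        then show "\<bar>((z n)(n := t)) k - x k\<bar> < c n"
          using y(1)[OF \<open>k < m\<close>] y(1)[OF \<open>n < m\<close>] dc[OF \<open>n < m\<close>] \<open>d > 0\<close> by (auto simp: z_def)
      next
        fix k assume "m \<le> k"
        then show "((z n)(n := t)) k = 0" using x0 y(2) \<open>n < m\<close> by (auto simp: z_def)
      qed
      have "norm (g ((z n)(n := y n)) - g ((z n)(n := x n)) - (y n - x n) *\<^sub>R partial_deriv n g x)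
          \<le> \<bar>y n - x n\<bar> * e"
      proof (rule norm_increment_bound[where \<phi> = "\<lambda>t. g ((z n)(n := t))"])
        fix t assume t: "t \<in> closed_segment (x n) (y n)"
        show "((\<lambda>t. g ((z n)(n := t))) has_vector_derivative partial_deriv n g ((z n)(n := t))) (at t)"
          unfolding has_partial_slice[symmetric]
          using zt[OF t] by (intro smooth_on_has_partial[OF g \<open>n < m\<close>]) auto
        show "norm (partial_deriv n g ((z n)(n := t)) - partial_deriv n g x) \<le> e"
          using zt[OF t] by (simp add: dist_norm)
      qed
      moreover have "(z n)(n := y n) = z (Suc n)" "(z n)(n := x n) = z n"
        by (auto simp: z_def)
      ultimately show ?thesis by simp
    qed
    have "g y - g x = (\<Sum>n<m. g (z (Suc n)) - g (z n))"
      by (simp add: sum_lessThan_telescope[of "\<lambda>n. g (z n)"] \<open>z 0 = x\<close> \<open>z m = y\<close>)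
    then have "norm (g y - g x - (\<Sum>k<m. (y k - x k) *\<^sub>R partial_deriv k g x))
      = norm (\<Sum>n<m. g (z (Suc n)) - g (z n) - (y n - x n) *\<^sub>R partial_deriv n g x)"
      by (simp add: sum_subtractf)
    also have "\<dots> \<le> (\<Sum>n<m. \<bar>y n - x n\<bar> * e)"
      by (rule sum_norm_le) (use step in auto)
    finally show ?thesis .
  qed
  with \<open>d > 0\<close> show ?thesis using that by blast
qed

text \<open>
  After subtracting the linear combination of the \<open>\<gamma> t k\<close>, the claim is that the remainder
  \<open>R\<close> has derivative \<open>0\<close>: by \<open>linear_approximation\<close> it is small compared with
  \<open>\<bar>\<gamma> t k - \<gamma> a k\<bar>\<close>, and these increments are at most of order \<open>\<bar>t - a\<bar>\<close>.
\<close>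

lemma chain_rule_curve:
  assumes S: "openin (Euclidean_space m) S" and g: "smooth_on m S g" and "\<gamma> a \<in> S"
    and van: "\<forall>\<^sub>F t in at a. \<forall>k\<ge>m. \<gamma> t k = 0"
    and der: "\<And>k. k < m \<Longrightarrow> ((\<lambda>t. \<gamma> t k) has_vector_derivative c k) (at a)"
  shows "((\<lambda>t. g (\<gamma> t)) has_vector_derivative (\<Sum>k<m. c k *\<^sub>R partial_deriv k g (\<gamma> a))) (at a)"
proof -
  define R where "R t = g (\<gamma> t) - (\<Sum>k<m. \<gamma> t k *\<^sub>R partial_deriv k g (\<gamma> a))" for t
  have lip: "\<forall>\<^sub>F t in at a. \<bar>\<gamma> t k - \<gamma> a k\<bar> \<le> (\<bar>c k\<bar> + 1) * \<bar>t - a\<bar>" if "k < m" for k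
  proof -
    have "\<forall>\<^sub>F t in at a. norm (\<gamma> t k - \<gamma> a k - (t - a) *\<^sub>R c k) \<le> 1 * norm (t - a)"
      using der[OF that, unfolded has_vector_derivative_def has_derivative_within_alt2]
      by (auto elim: allE[of _ "1::real"])
    then show ?thesis
    proof (rule eventually_mono)
      fix t assume "norm (\<gamma> t k - \<gamma> a k - (t - a) *\<^sub>R c k) \<le> 1 * norm (t - a)"
      moreover have "\<bar>\<gamma> t k - \<gamma> a k\<bar> \<le> \<bar>\<gamma> t k - \<gamma> a k - (t - a) * c k\<bar> + \<bar>(t - a) * c k\<bar>"
        by linarith
      ultimately show "\<bar>\<gamma> t k - \<gamma> a k\<bar> \<le> (\<bar>c k\<bar> + 1) * \<bar>t - a\<bar>"
        unfolding abs_mult by (simp add: distrib_left mult.commute)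
    qed
  qed
  have near: "\<forall>\<^sub>F t in at a. \<bar>\<gamma> t k - \<gamma> a k\<bar> < d" if "k < m" "d > 0" for k d
  proof -
    have "((\<lambda>t. \<gamma> t k) \<longlongrightarrow> \<gamma> a k) (at a)"
      using has_vector_derivative_continuous[OF der[OF that(1)]] by (simp add: continuous_at)
    then show ?thesis using that(2) by (auto simp: tendsto_iff dist_real_def)
  qed
  \<comment> \<open>The last \<open>1\<close> makes \<open>C\<close> positive also for \<open>m = 0\<close>.\<close>
  define C where "C = (\<Sum>k<m. \<bar>c k\<bar> + 1) + 1"
  have "C > 0" unfolding C_def by (intro add_nonneg_pos sum_nonneg) auto
  have "(R has_vector_derivative 0) (at a)"
    unfolding has_vector_derivative_def has_derivative_within_alt2
  proof (intro conjI allI impI)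
    fix e :: real assume "e > 0"
    then have "e / C > 0" using \<open>C > 0\<close> by simp
    from linear_approximation[OF S g \<open>\<gamma> a \<in> S\<close> this]
    obtain d where d: "d > 0"
      "\<And>y. (\<And>k. k < m \<Longrightarrow> \<bar>y k - \<gamma> a k\<bar> < d) \<Longrightarrow> (\<And>k. m \<le> k \<Longrightarrow> y k = 0) \<Longrightarrow>
      norm (g y - g (\<gamma> a) - (\<Sum>k<m. (y k - \<gamma> a k) *\<^sub>R partial_deriv k g (\<gamma> a))) \<le> (\<Sum>k<m. \<bar>y k - \<gamma> a k\<bar> * (e / C))"
      by blast
    have "\<forall>\<^sub>F t in at a. (\<forall>k\<in>{..<m}. \<bar>\<gamma> t k - \<gamma> a k\<bar> < d \<and> \<bar>\<gamma> t k - \<gamma> a k\<bar> \<le> (\<bar>c k\<bar> + 1) * \<bar>t - a\<bar>)"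
      using near lip d(1) by (intro eventually_ball_finite) (auto intro: eventually_conj)
    with van show "\<forall>\<^sub>F t in at a. norm (R t - R a - (t - a) *\<^sub>R 0) \<le> e * norm (t - a)"
    proof eventually_elim
      case (elim t)
      have "R t - R a = g (\<gamma> t) - g (\<gamma> a) - (\<Sum>k<m. (\<gamma> t k - \<gamma> a k) *\<^sub>R partial_deriv k g (\<gamma> a))"
        by (simp add: R_def scaleR_diff_left sum_subtractf)
      then have "norm (R t - R a) \<le> (\<Sum>k<m. \<bar>\<gamma> t k - \<gamma> a k\<bar> * (e / C))"
        using d(2)[of "\<gamma> t"] elim by auto
      also have "\<dots> \<le> (\<Sum>k<m. ((\<bar>c k\<bar> + 1) * \<bar>t - a\<bar>) * (e / C))"
        using elim \<open>e / C > 0\<close> by (intro sum_mono mult_right_mono) auto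
      also have "\<dots> = (C - 1) * (\<bar>t - a\<bar> * (e / C))"
        by (simp only: C_def add_diff_cancel_right' sum_distrib_right mult.assoc)
      also have "\<dots> \<le> C * (\<bar>t - a\<bar> * (e / C))"
        using \<open>e / C > 0\<close> by (intro mult_right_mono mult_nonneg_nonneg) auto
      finally show ?case using \<open>C > 0\<close> by (simp add: mult.commute)
    qed
  qed simp
  moreover have "((\<lambda>t. \<Sum>k<m. \<gamma> t k *\<^sub>R partial_deriv k g (\<gamma> a)) has_vector_derivative
      (\<Sum>k<m. c k *\<^sub>R partial_deriv k g (\<gamma> a))) (at a)"
  proof (rule has_vector_derivative_sum)
    fix k assume "k \<in> {..<m}"
    then have "((\<lambda>t. \<gamma> t k) has_field_derivative c k) (at a)"
      using der[of k] by (simp add: has_real_derivative_iff_has_vector_derivative)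
    from has_vector_derivative_scaleR[OF this has_vector_derivative_const]
    show "((\<lambda>t. \<gamma> t k *\<^sub>R partial_deriv k g (\<gamma> a)) has_vector_derivative
      c k *\<^sub>R partial_deriv k g (\<gamma> a)) (at a)" by simp
  qed
  ultimately have "((\<lambda>t. R t + (\<Sum>k<m. \<gamma> t k *\<^sub>R partial_deriv k g (\<gamma> a))) has_vector_derivative
      0 + (\<Sum>k<m. c k *\<^sub>R partial_deriv k g (\<gamma> a))) (at a)"
    by (rule has_vector_derivative_add)
  then show ?thesis by (simp add: R_def)
qed

section \<open>Composition of smooth maps\<close>

text \<open>
  The class \<open>C\<^sup>n\<close>.  Recursion on the order of differentiability makes closure under products and
  compositions an induction: the derivative of a composite is a sum of products of functions
  to which the induction hypothesis applies, without a formula for higher derivatives.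
\<close>

primrec C_on :: "nat \<Rightarrow> nat \<Rightarrow> (nat \<Rightarrow> real) set \<Rightarrow> ((nat \<Rightarrow> real) \<Rightarrow> 'b::real_normed_vector) \<Rightarrow> bool" where
  "C_on 0 m S g \<longleftrightarrow> continuous_on S g"
| "C_on (Suc n) m S g \<longleftrightarrow> continuous_on S g \<and>
     (\<forall>j<m. (\<forall>x\<in>S. has_partial g j (partial_deriv j g x) x) \<and> C_on n m S (partial_deriv j g))"

lemma C_on_continuous: "C_on n m S g \<Longrightarrow> continuous_on S g"
  by (cases n) auto

lemma C_on_Suc_D: "C_on (Suc n) m S g \<Longrightarrow> C_on n m S g"
  by (induction n arbitrary: g) auto

lemma smooth_on_iff_C_on: "smooth_on m S g \<longleftrightarrow> (\<forall>n. C_on n m S g)"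
proof
  assume "smooth_on m S g"
  then have "C_on n m S g" for n
  proof (induction n arbitrary: g)
    case (Suc n)
    then show ?case using smooth_on_unfold[of m S g] by simp
  qed (simp add: smooth_on_continuous)
  then show "\<forall>n. C_on n m S g" ..
next
  assume g: "\<forall>n. C_on n m S g"
  have C: "\<forall>n. C_on n m S (iter_partial_deriv js g)" if "set js \<subseteq> {..<m}" for js
    using that
  proof (induction js)
    case (Cons j js)
    then have "C_on (Suc n) m S (iter_partial_deriv js g)" for n by auto
    then show ?case using Cons.prems by simp
  qed (simp add: g)
  show "smooth_on m S g"
    unfolding smooth_on_def has_partial_iff_differentiable
  proof (intro allI impI conjI ballI)
    fix js :: "nat list" assume js: "set js \<subseteq> {..<m}"
    show "continuous_on S (iter_partial_deriv js g)"
      using C[OF js] C_on_continuous by blast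
    fix x j assume "x \<in> S" "j < m"
    with C[OF js, rule_format, of "Suc 0"]
    show "has_partial (iter_partial_deriv js g) j (partial_deriv j (iter_partial_deriv js g) x) x"
      by auto
  qed
qed

lemma C_on_cong:
  assumes S: "openin (Euclidean_space m) S"
  shows "C_on n m S f \<Longrightarrow> (\<And>x. x \<in> S \<Longrightarrow> f x = h x) \<Longrightarrow> C_on n m S h"
proof (induction n arbitrary: f h)
  case 0
  then show ?case by (simp cong: continuous_on_cong)
next
  case (Suc n)
  have eq: "partial_deriv j f x = partial_deriv j h x" if "x \<in> S" "j < m" for j x
    using partial_deriv_cong[OF S that] Suc.prems(2) by blast
  have "has_partial h j (partial_deriv j h x) x" if "x \<in> S" "j < m" for j x
  proof -
    have "has_partial f j (partial_deriv j f x) x" using Suc.prems(1) that by simp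
    then show ?thesis unfolding eq[OF that]
      using has_partial_cong[OF S that, of f h] Suc.prems(2) by blast
  qed
  moreover have "C_on n m S (partial_deriv j h)" if "j < m" for j
    by (rule Suc.IH[of "partial_deriv j f"]) (use Suc.prems(1) eq that in auto)
  moreover have "continuous_on S h"
    using C_on_continuous[OF Suc.prems(1)] Suc.prems(2) by (simp cong: continuous_on_cong)
  ultimately show ?case by simp
qed

text \<open>
  Derivatives need to be known on \<open>S\<close> only, and may be given by any convenient formula.
\<close>

lemma C_on_SucI:
  assumes S: "openin (Euclidean_space m) S" and "continuous_on S g"
    and D: "\<And>j x. j < m \<Longrightarrow> x \<in> S \<Longrightarrow> has_partial g j (D j x) x"
    and C: "\<And>j. j < m \<Longrightarrow> C_on n m S (D j)"
  shows "C_on (Suc n) m S g"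
proof -
  have eq: "partial_deriv j g x = D j x" if "j < m" "x \<in> S" for j x
    using has_partial_imp_partial_deriv[OF D[OF that]] .
  then have "C_on n m S (partial_deriv j g)" if "j < m" for j
    using C_on_cong[OF S C[OF that]] that by simp
  with assms(2) D eq show ?thesis by simp
qed

lemma C_on_const:
  assumes S: "openin (Euclidean_space m) S"
  shows "C_on n m S (\<lambda>x. c)"
proof (induction n arbitrary: c)
  case (Suc n)
  show ?case
    by (rule C_on_SucI[OF S, where D = "\<lambda>j x. 0"]) (auto simp: Suc has_partial_def)
qed simp

lemma C_on_add:
  assumes S: "openin (Euclidean_space m) S"
  shows "C_on n m S f \<Longrightarrow> C_on n m S g \<Longrightarrow> C_on n m S (\<lambda>x. f x + g x)"
proof (induction n arbitrary: f g)
  case 0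
  then show ?case by (simp add: continuous_on_add)
next
  case (Suc n)
  show ?case
  proof (rule C_on_SucI[OF S])
    show "continuous_on S (\<lambda>x. f x + g x)"
      using Suc.prems by (auto intro: continuous_on_add)
    show "has_partial (\<lambda>x. f x + g x) j (partial_deriv j f x + partial_deriv j g x) x"
      if "j < m" "x \<in> S" for j x
      using Suc.prems that unfolding has_partial_def by (intro has_vector_derivative_add) (auto simp: has_partial_def)
  qed (use Suc in auto)
qed

lemma C_on_sum:
  assumes S: "openin (Euclidean_space m) S"
    and "\<And>k. k < (r::nat) \<Longrightarrow> C_on n m S (f k)"
  shows "C_on n m S (\<lambda>x. \<Sum>k<r. f k x)"
  using assms(2) by (induction r) (auto intro: C_on_add[OF S] C_on_const[OF S])

lemma C_on_scaleR:
  assumes S: "openin (Euclidean_space m) S"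
  shows "C_on n m S a \<Longrightarrow> C_on n m S g \<Longrightarrow> C_on n m S (\<lambda>x. a x *\<^sub>R g x)"
proof (induction n arbitrary: a g)
  case 0
  then show ?case by (simp add: continuous_on_scaleR)
next
  case (Suc n)
  note lower = C_on_Suc_D[OF Suc.prems(1)] C_on_Suc_D[OF Suc.prems(2)]
  show ?case
  proof (rule C_on_SucI[OF S])
    show "continuous_on S (\<lambda>x. a x *\<^sub>R g x)"
      using Suc.prems by (auto intro: continuous_on_scaleR)
    show "has_partial (\<lambda>x. a x *\<^sub>R g x) j (a x *\<^sub>R partial_deriv j g x + partial_deriv j a x *\<^sub>R g x) x"
      if "j < m" "x \<in> S" for j x
    proof -
      have "has_partial a j (partial_deriv j a x) x" "has_partial g j (partial_deriv j g x) x"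
        using Suc.prems that by auto
      then show ?thesis
        unfolding has_partial_def has_real_derivative_iff_has_vector_derivative[symmetric]
        by (auto dest: has_vector_derivative_scaleR)
    qed
    show "C_on n m S (\<lambda>x. a x *\<^sub>R partial_deriv j g x + partial_deriv j a x *\<^sub>R g x)" if "j < m" for j
      using Suc.prems that lower by (intro C_on_add[OF S] Suc.IH) auto
  qed
qed

text \<open>
  By the chain rule each partial derivative of the composite is a sum of products of derivatives
  of \<open>T\<close> with composites \<open>h \<circ> T\<close>, where \<open>h\<close> is again smooth; so membership in \<open>C\<^sup>n\<close> is
  proved for all smooth \<open>g\<close> at once, by induction on \<open>n\<close>.
\<close>

lemma smooth_on_compose:
  assumes S: "openin (Euclidean_space m) S" and g: "smooth_on m S g"
    and S': "openin (Euclidean_space m) S'" and T: "T ` S' \<subseteq> S"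
    and smT: "\<And>k. k < m \<Longrightarrow> smooth_on m S' (\<lambda>y. T y k)"
  shows "smooth_on m S' (\<lambda>y. g (T y))"
proof -
  have "continuous_on S' (\<lambda>y. T y k)" for k
  proof (cases "k < m")
    case True
    then show ?thesis using smT smooth_on_continuous by blast
  next
    case False
    have "continuous_on S' (\<lambda>y. 0::real)" by simp
    then show ?thesis
      by (rule continuous_on_eq) (use T False Euclidean_space_vanish[OF S] in force)
  qed
  then have contT: "continuous_on S' T" by (rule continuous_on_coordinatewise_then_product)
  have "C_on n m S' (\<lambda>y. g (T y))" for n
    using g
  proof (induction n arbitrary: g)
    case 0
    show ?case
      using continuous_on_compose2[OF smooth_on_continuous[OF 0] contT T] by simp
  next
    case (Suc n)
    show ?case
    proof (rule C_on_SucI[OF S'])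
      show "continuous_on S' (\<lambda>y. g (T y))"
        using smooth_on_continuous[OF Suc.prems] contT T by (rule continuous_on_compose2)
      show "has_partial (\<lambda>y. g (T y)) j
          (\<Sum>k<m. partial_deriv j (\<lambda>y. T y k) y *\<^sub>R partial_deriv k g (T y)) y"
        if "j < m" "y \<in> S'" for j y
      proof -
        let ?\<gamma> = "\<lambda>t. T (y(j := t))"
        have a: "?\<gamma> (y j) = T y" by simp
        obtain d where d: "d > 0" "\<And>t. \<bar>t - y j\<bar> < d \<Longrightarrow> y(j := t) \<in> S'"
          using openin_Euclidean_space_slice[OF S' \<open>y \<in> S'\<close> \<open>j < m\<close>] by blast
        have "\<forall>\<^sub>F t in at (y j). \<forall>k\<ge>m. ?\<gamma> t k = 0"
          unfolding eventually_at using d T Euclidean_space_vanish[OF S]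
          by (intro exI[of _ d]) (auto simp: dist_real_def image_subset_iff)
        moreover have "((\<lambda>t. ?\<gamma> t k) has_vector_derivative partial_deriv j (\<lambda>y. T y k) y) (at (y j))"
          if "k < m" for k
          using smooth_on_has_partial[OF smT[OF that] \<open>j < m\<close> \<open>y \<in> S'\<close>] by (simp add: has_partial_def)
        ultimately show ?thesis
          using chain_rule_curve[OF S Suc.prems, of ?\<gamma> "y j" "\<lambda>k. partial_deriv j (\<lambda>y. T y k) y"] T that(2)
          by (auto simp: has_partial_def)
      qed
      show "C_on n m S' (\<lambda>y. \<Sum>k<m. partial_deriv j (\<lambda>y. T y k) y *\<^sub>R partial_deriv k g (T y))"
        if "j < m" for j
        using smooth_on_partial_deriv[OF smT that] smooth_on_partial_deriv[OF Suc.prems] Suc.IH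
        by (intro C_on_sum[OF S'] C_on_scaleR[OF S']) (auto simp: smooth_on_iff_C_on)
    qed
  qed
  then show ?thesis by (simp add: smooth_on_iff_C_on)
qed

lemma smooth_on_cong:
  assumes "openin (Euclidean_space m) S" "smooth_on m S f" "\<And>x. x \<in> S \<Longrightarrow> f x = h x"
  shows "smooth_on m S h"
  using assms C_on_cong[OF assms(1)] unfolding smooth_on_iff_C_on by blast

lemma smooth_on_subset: "smooth_on m S g \<Longrightarrow> R \<subseteq> S \<Longrightarrow> smooth_on m R g"
  unfolding smooth_on_def by (meson continuous_on_subset subsetD)

section \<open>Limits of smooth functions\<close>

text \<open>
  If all derivatives converge uniformly, differentiation commutes with the limit; applied to
  slices \<open>t \<mapsto> x(j := t)\<close>, the one-dimensional theorem on derivatives of sequences identifies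
  every iterated derivative of the limit by induction on the list of directions.
\<close>

lemma smooth_on_limit:
  fixes u :: "nat \<Rightarrow> (nat \<Rightarrow> real) \<Rightarrow> 'b::banach"
  assumes S: "openin (Euclidean_space m) S" and u: "\<And>n. smooth_on m S (u n)"
    and lim: "\<And>x. x \<in> S \<Longrightarrow> (\<lambda>n. u n x) \<longlonglongrightarrow> f x"
    and Cau: "\<And>js. set js \<subseteq> {..<m} \<Longrightarrow> uniformly_Cauchy_on S (\<lambda>n. iter_partial_deriv js (u n))"
  shows "smooth_on m S f"
    and "\<And>js x. set js \<subseteq> {..<m} \<Longrightarrow> x \<in> S \<Longrightarrow>
      (\<lambda>n. iter_partial_deriv js (u n) x) \<longlonglongrightarrow> iter_partial_deriv js f x"
proof -
  define G where "G js x = lim (\<lambda>n. iter_partial_deriv js (u n) x)" for js x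
  have unif: "uniform_limit S (\<lambda>n. iter_partial_deriv js (u n)) (G js) sequentially"
    if "set js \<subseteq> {..<m}" for js
    using Cau[OF that] unfolding G_def uniformly_convergent_uniform_limit_iff[symmetric]
    by (rule Cauchy_uniformly_convergent)
  have contG: "continuous_on S (G js)" if "set js \<subseteq> {..<m}" for js
    using unif[OF that] by (rule uniform_limit_theorem[rotated])
      (intro trivial_limit_sequentially always_eventually allI
        smooth_on_continuous[OF smooth_on_iter[OF u that]])+
  have partG: "has_partial (G js) j (G (j # js) x) x" if "set (j # js) \<subseteq> {..<m}" "x \<in> S" for j js x
  proof -
    have js: "set js \<subseteq> {..<m}" "j < m" using that by auto
    obtain d where d: "d > 0" "\<And>t. \<bar>t - x j\<bar> < d \<Longrightarrow> x(j := t) \<in> S"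
      using openin_Euclidean_space_slice[OF S \<open>x \<in> S\<close> js(2)] by blast
    have I: "x(j := t) \<in> S" if "t \<in> ball (x j) d" for t
      using that d(2) by (simp add: dist_real_def abs_minus_commute)
    have "\<exists>h. \<forall>t\<in>ball (x j) d. (\<lambda>n. iter_partial_deriv js (u n) (x(j := t))) \<longlonglongrightarrow> h t \<and>
      (h has_derivative (\<lambda>s. s *\<^sub>R G (j # js) (x(j := t)))) (at t within ball (x j) d)"
    proof (rule has_derivative_sequence[where f' = "\<lambda>n t s. s *\<^sub>R iter_partial_deriv (j # js) (u n) (x(j := t))"])
      fix n t assume "t \<in> ball (x j) d"
      with I smooth_on_has_partial[OF smooth_on_iter[OF u js(1)] js(2)]
      have "has_partial (iter_partial_deriv js (u n)) j (iter_partial_deriv (j # js) (u n) (x(j := t))) (x(j := t))"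
        by simp
      then show "((\<lambda>t. iter_partial_deriv js (u n) (x(j := t))) has_derivative
          (\<lambda>s. s *\<^sub>R iter_partial_deriv (j # js) (u n) (x(j := t)))) (at t within ball (x j) d)"
        unfolding has_partial_slice has_vector_derivative_def by (rule has_derivative_at_withinI)
    next
      fix e :: real assume "e > 0"
      with unif[OF that(1)] have "\<forall>\<^sub>F n in sequentially. \<forall>y\<in>S.
          dist (iter_partial_deriv (j # js) (u n) y) (G (j # js) y) < e"
        unfolding uniform_limit_iff by blast
      then show "\<forall>\<^sub>F n in sequentially. \<forall>t\<in>ball (x j) d. \<forall>s. norm (s *\<^sub>R iter_partial_deriv (j # js) (u n) (x(j := t))
          - s *\<^sub>R G (j # js) (x(j := t))) \<le> e * norm s"
      proof (rule eventually_mono)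
        fix n assume n: "\<forall>y\<in>S. dist (iter_partial_deriv (j # js) (u n) y) (G (j # js) y) < e"
        show "\<forall>t\<in>ball (x j) d. \<forall>s. norm (s *\<^sub>R iter_partial_deriv (j # js) (u n) (x(j := t))
          - s *\<^sub>R G (j # js) (x(j := t))) \<le> e * norm s"
        proof (intro ballI allI)
          fix t s assume "t \<in> ball (x j) d"
          then have "norm (iter_partial_deriv (j # js) (u n) (x(j := t)) - G (j # js) (x(j := t))) \<le> e"
            using n I by (auto simp: dist_norm intro: less_imp_le)
          from mult_left_mono[OF this abs_ge_zero[of s]]
          show "norm (s *\<^sub>R iter_partial_deriv (j # js) (u n) (x(j := t))
            - s *\<^sub>R G (j # js) (x(j := t))) \<le> e * norm s"
            by (simp add: scaleR_diff_right[symmetric] mult.commute del: iter_partial_deriv.simps)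
        qed
      qed
    next
      show "(\<lambda>n. iter_partial_deriv js (u n) (x(j := x j))) \<longlonglongrightarrow> G js x"
        using tendsto_uniform_limitI[OF unif[OF js(1)] \<open>x \<in> S\<close>] by simp
    qed (use d in auto)
    then obtain h where h: "\<And>t. t \<in> ball (x j) d \<Longrightarrow> (\<lambda>n. iter_partial_deriv js (u n) (x(j := t))) \<longlonglongrightarrow> h t"
      "\<And>t. t \<in> ball (x j) d \<Longrightarrow> (h has_derivative (\<lambda>s. s *\<^sub>R G (j # js) (x(j := t)))) (at t within ball (x j) d)"
      by blast
    have "(h has_vector_derivative G (j # js) x) (at (x j))"
      using h(2)[of "x j"] d(1) by (simp add: has_vector_derivative_def at_within_open[OF _ open_ball])
    moreover have "h t = G js (x(j := t))" if "t \<in> ball (x j) d" for t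
      using h(1)[OF that] tendsto_uniform_limitI[OF unif[OF js(1)] I[OF that]] by (rule LIMSEQ_unique)
    ultimately show ?thesis
      unfolding has_partial_def using d(1)
      by (elim has_vector_derivative_transform_within_open[where S = "ball (x j) d"]) auto
  qed
  have eq: "iter_partial_deriv js f x = G js x" if "set js \<subseteq> {..<m}" "x \<in> S" for js x
    using that
  proof (induction js arbitrary: x)
    case Nil
    then show ?case unfolding G_def using limI[OF lim] by simp
  next
    case (Cons j js)
    then have "iter_partial_deriv (j # js) f x = partial_deriv j (G js) x"
      unfolding iter_partial_deriv.simps by (intro partial_deriv_cong[OF S]) auto
    then show ?case using has_partial_imp_partial_deriv[OF partG[OF Cons.prems]] by simp
  qed
  show "smooth_on m S f"
    unfolding smooth_on_def has_partial_iff_differentiable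
  proof (intro allI impI conjI ballI)
    fix js :: "nat list" assume js: "set js \<subseteq> {..<m}"
    show "continuous_on S (iter_partial_deriv js f)"
      using contG[OF js] eq[OF js] by (simp cong: continuous_on_cong)
    fix x j assume xj: "x \<in> S" "j < m"
    have "has_partial (iter_partial_deriv js f) j (G (j # js) x) x"
      using partG[of j js x] js xj has_partial_cong[OF S xj, of "iter_partial_deriv js f" "G js"] eq[OF js]
      by simp
    then show "has_partial (iter_partial_deriv js f) j (partial_deriv j (iter_partial_deriv js f) x) x"
      using has_partial_imp_partial_deriv by metis
  qed
  show "(\<lambda>n. iter_partial_deriv js (u n) x) \<longlonglongrightarrow> iter_partial_deriv js f x"
    if "set js \<subseteq> {..<m}" "x \<in> S" for js x
    using tendsto_uniform_limitI[OF unif[OF that(1)] that(2)] eq[OF that] by simp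
qed

section \<open>The semi-norms on smooth functions\<close>

lemma is_chart_inj_on: "is_chart X m c \<Longrightarrow> inj_on (snd c) (fst c)"
  unfolding is_chart_def
  by (metis homeomorphic_imp_injective_map openin_subset topspace_subtopology_subset)

lemma coord_rep_chart:
  assumes "is_chart X m c" "p \<in> fst c"
  shows "coord_rep c f (snd c p) = f p"
  using is_chart_inj_on[OF assms(1)] assms(2) by (simp add: coord_rep_def)

lemma is_chart_image_open:
  assumes "is_chart X m c" "openin X W" "W \<subseteq> fst c"
  shows "openin (Euclidean_space m) (snd c ` W)"
proof -
  have "openin (subtopology (Euclidean_space m) (chart_image c)) (snd c ` W)"
    using assms unfolding is_chart_def
    by (meson homeomorphic_imp_open_map open_map_def openin_open_subtopology)
  then show ?thesis
    using assms(1) openin_trans_full unfolding is_chart_def by blast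
qed

lemma is_chart_continuous_map:
  assumes "is_chart X m c" "continuous_on (chart_image c) g"
  shows "continuous_map (subtopology X (fst c)) euclidean (\<lambda>p. g (snd c p))"
proof -
  have sub: "subtopology (Euclidean_space m) (chart_image c) = top_of_set (chart_image c)"
    using assms(1) unfolding is_chart_def by (intro subtopology_Euclidean_space openin_subset) auto
  have "continuous_map (subtopology X (fst c)) (top_of_set (chart_image c)) (snd c)"
    using assms(1) homeomorphic_imp_continuous_map unfolding is_chart_def sub by blast
  moreover have "continuous_map (top_of_set (chart_image c)) euclidean g"
    using assms(2) by (simp add: continuous_map_iff_continuous)
  ultimately show ?thesis using continuous_map_compose unfolding comp_def by blast
qed

text \<open>
  Strict violation of the bound is an open condition, so it would also occur on \<open>S\<close>.
\<close>

lemma closure_of_bound: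
  fixes h :: "'a \<Rightarrow> real"
  assumes W: "openin X W" and h: "continuous_map (subtopology X W) euclidean h"
    and "\<And>p. p \<in> S \<Longrightarrow> h p \<le> B" and "p \<in> X closure_of S" "p \<in> W"
  shows "h p \<le> B"
proof (rule ccontr)
  assume "\<not> h p \<le> B"
  have "openin (subtopology X W) {q \<in> topspace (subtopology X W). h q \<in> {B<..}}"
    by (rule openin_continuous_map_preimage[OF h]) simp
  then have "openin X {q \<in> topspace (subtopology X W). h q \<in> {B<..}}"
    using W openin_trans_full by blast
  moreover have "p \<in> {q \<in> topspace (subtopology X W). h q \<in> {B<..}}"
    using \<open>\<not> h p \<le> B\<close> \<open>p \<in> W\<close> openin_subset[OF W] by auto
  ultimately obtain q where "q \<in> S" "h q \<in> {B<..}"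
    using assms(4) unfolding in_closure_of by (metis (mono_tags, lifting) mem_Collect_eq)
  with assms(3) show False by force
qed

abbreviation multi_word :: "nat \<Rightarrow> (nat \<Rightarrow> nat) \<Rightarrow> nat list" where
  "multi_word m I \<equiv> concat (map (\<lambda>j. replicate (I j) j) [0..<m])"

lemma set_multi_word: "set (multi_word m I) \<subseteq> {..<m}"
  by (auto split: if_splits)

lemma finite_multi_indices: "finite {I \<in> multi_indices m. multi_order m I \<le> l}"
proof (rule finite_subset)
  have "I j \<le> l" if "multi_order m I \<le> l" "j < m" for I j
    using member_le_sum[of j "{..<m}" I] that by (simp add: multi_order_def)
  then show "{I \<in> multi_indices m. multi_order m I \<le> l}
    \<subseteq> {I. \<forall>j. (j \<in> {..<m} \<longrightarrow> I j \<in> {..l}) \<and> (j \<notin> {..<m} \<longrightarrow> I j = 0)}"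
    by (auto simp: multi_indices_def)
  show "finite {I. \<forall>j. (j \<in> {..<m} \<longrightarrow> I j \<in> {..l}) \<and> (j \<notin> {..<m} \<longrightarrow> I j = (0::nat))}"
    by (rule finite_set_of_finite_funs) auto
qed

locale covered_manifold =
  fixes X :: "'a topology" and m :: nat and A :: "'a chart set"
    and J :: "nat set" and U :: "nat \<Rightarrow> 'a set" and \<xi> :: "nat \<Rightarrow> 'a chart"
  assumes manifold: "smooth_manifold X m A" and covering: "admissible_covering X A J U \<xi>"
begin

lemma chart: "c \<in> A \<Longrightarrow> is_chart X m c"
  using manifold unfolding smooth_manifold_def by blast

lemma covering_facts:
  "\<forall>i\<in>J. openin X (U i)" "(\<Union>i\<in>J. U i) = topspace X"
  "\<forall>K. finite K \<and> K \<subseteq> J \<longrightarrow> compactin X (X closure_of (\<Union>i\<in>K. U i))"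
  "\<forall>i\<in>J. \<xi> i \<in> A \<and> X closure_of (U i) \<subseteq> fst (\<xi> i)"
  using covering unfolding admissible_covering_def by auto

lemma U_open: "i \<in> J \<Longrightarrow> openin X (U i)"
  and \<xi>_in_atlas: "i \<in> J \<Longrightarrow> \<xi> i \<in> A"
  and closure_U_subset: "i \<in> J \<Longrightarrow> X closure_of (U i) \<subseteq> fst (\<xi> i)"
  using covering_facts(1,4) by simp_all

lemma U_covers:
  assumes "p \<in> topspace X"
  obtains i where "i \<in> J" "p \<in> U i"
  using assms covering_facts(2) by blast

lemma \<xi>_chart: "i \<in> J \<Longrightarrow> is_chart X m (\<xi> i)"
  by (simp add: chart \<xi>_in_atlas)

lemma closure_U_compact:
  assumes "i \<in> J" shows "compactin X (X closure_of (U i))"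
  using covering_facts(3)[rule_format, of "{i}"] assms by simp

lemma U_subset_closure: "i \<in> J \<Longrightarrow> U i \<subseteq> X closure_of (U i)"
  using U_open by (simp add: closure_of_subset openin_subset)

abbreviation smooth_funs :: "('a \<Rightarrow> 'k::{real_normed_field, euclidean_space}) set" where
  "smooth_funs \<equiv> smooth_functions X m A"

abbreviation Csemi :: "nat \<Rightarrow> ('a \<Rightarrow> 'k::{real_normed_field, euclidean_space}) \<Rightarrow> real" where
  "Csemi \<equiv> Cinf_seminorm X m J U \<xi>"

definition deriv_at :: "nat \<Rightarrow> (nat \<Rightarrow> nat) \<Rightarrow> ('a \<Rightarrow> 'k::{real_normed_field, euclidean_space}) \<Rightarrow> 'a \<Rightarrow> 'k" where
  "deriv_at i I f p = multi_deriv m I (coord_rep (\<xi> i) f) (snd (\<xi> i) p)"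

lemma deriv_at_0: "i \<in> J \<Longrightarrow> p \<in> fst (\<xi> i) \<Longrightarrow> deriv_at i (\<lambda>_. 0) f p = f p"
  using coord_rep_chart[OF \<xi>_chart]
  by (simp add: deriv_at_def multi_deriv_def map_replicate_const)

lemma smooth_funs_smooth_on:
  "f \<in> smooth_funs \<Longrightarrow> i \<in> J \<Longrightarrow> smooth_on m (chart_image (\<xi> i)) (coord_rep (\<xi> i) f)"
  unfolding smooth_functions_def using \<xi>_in_atlas by blast

lemma chart_image_open: "c \<in> A \<Longrightarrow> openin (Euclidean_space m) (chart_image c)"
  using chart unfolding is_chart_def by blast

lemma coord_rep_lincomb:
  "coord_rep c (\<lambda>x. a * f x + b * g x) = (\<lambda>y. a * coord_rep c f y + b * coord_rep c g y)"
  by (simp add: coord_rep_def fun_eq_iff)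

lemma smooth_funs_lincomb:
  assumes "f \<in> smooth_funs" "g \<in> smooth_funs"
  shows "(\<lambda>x. a * f x + b * g x) \<in> smooth_funs"
proof -
  have "smooth_on m (chart_image c) (coord_rep c (\<lambda>x. a * f x + b * g x))" if "c \<in> A" for c
    using assms that unfolding smooth_functions_def coord_rep_lincomb
    by (intro smooth_on_lincomb[OF chart_image_open[OF that]]) blast+
  then show ?thesis using assms by (simp add: smooth_functions_def)
qed

lemma deriv_at_lincomb:
  assumes "f \<in> smooth_funs" "g \<in> smooth_funs" "i \<in> J" "p \<in> fst (\<xi> i)"
  shows "deriv_at i I (\<lambda>x. a * f x + b * g x) p = a * deriv_at i I f p + b * deriv_at i I g p"
  unfolding deriv_at_def coord_rep_lincomb multi_deriv_def
  by (rule iter_partial_deriv_lincomb[OF chart_image_open[OF \<xi>_in_atlas] smooth_funs_smooth_on smooth_funs_smooth_on])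
    (use assms set_multi_word in auto)

lemma deriv_at_continuous:
  assumes "f \<in> smooth_funs" "i \<in> J"
  shows "continuous_map (subtopology X (fst (\<xi> i))) euclidean (\<lambda>p. norm (deriv_at i I f p))"
proof -
  have "continuous_on (chart_image (\<xi> i)) (\<lambda>y. norm (multi_deriv m I (coord_rep (\<xi> i) f) y))"
    unfolding multi_deriv_def
    by (intro continuous_on_norm smooth_on_continuous[OF smooth_on_iter[OF smooth_funs_smooth_on[OF assms]]] set_multi_word)
  from is_chart_continuous_map[OF \<xi>_chart[OF assms(2)] this]
  show ?thesis unfolding deriv_at_def .
qed

lemma Csemi_eq:
  "Csemi l f = Sup (insert 0 (\<Union>i\<in>{i\<in>J. i \<le> l}. \<Union>I\<in>{I\<in>multi_indices m. multi_order m I \<le> l}.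
     (\<lambda>p. norm (deriv_at i I f p)) ` (X closure_of (U i))))"
  unfolding Cinf_seminorm_def deriv_at_def by (rule arg_cong[where f = Sup]) blast

text \<open>
  Finitely many \<open>i\<close> and \<open>I\<close> occur, and for each pair a continuous function is evaluated
  on a compact closure.  Without a bound the real supremum would be unspecified.
\<close>

lemma derivs_bdd_above:
  assumes "f \<in> smooth_funs"
  shows "bdd_above (insert 0 (\<Union>i\<in>{i\<in>J. i \<le> l}. \<Union>I\<in>{I\<in>multi_indices m. multi_order m I \<le> l}.
     (\<lambda>p. norm (deriv_at i I f p)) ` (X closure_of (U i))))"
proof -
  have "bdd_above ((\<lambda>p. norm (deriv_at i I f p)) ` (X closure_of (U i)))" if "i \<in> J" for i I
  proof -
    have "compactin (subtopology X (fst (\<xi> i))) (X closure_of (U i))"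
      using closure_U_compact closure_U_subset that by (simp add: compactin_subtopology)
    from image_compactin[OF this deriv_at_continuous[OF assms that]]
    show ?thesis
      by (auto intro!: bounded_imp_bdd_above compact_imp_bounded)
  qed
  then show ?thesis using finite_multi_indices by auto
qed

lemma Csemi_upper:
  assumes "f \<in> smooth_funs" "i \<in> J" "i \<le> l" "p \<in> X closure_of (U i)" "I \<in> multi_indices m" "multi_order m I \<le> l"
  shows "norm (deriv_at i I f p) \<le> Csemi l f"
  unfolding Csemi_eq by (rule cSup_upper[OF _ derivs_bdd_above[OF assms(1)]]) (use assms in blast)

lemma Csemi_nonneg: "f \<in> smooth_funs \<Longrightarrow> 0 \<le> Csemi l f"
  unfolding Csemi_eq by (rule cSup_upper[OF _ derivs_bdd_above]) auto

lemma Csemi_least: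
  assumes "0 \<le> B" "\<And>i p I. i \<in> J \<Longrightarrow> i \<le> l \<Longrightarrow> p \<in> X closure_of (U i) \<Longrightarrow> I \<in> multi_indices m \<Longrightarrow>
    multi_order m I \<le> l \<Longrightarrow> norm (deriv_at i I f p) \<le> B"
  shows "Csemi l f \<le> B"
  unfolding Csemi_eq by (rule cSup_least) (use assms in auto)

lemma Csemi_lincomb:
  assumes "f \<in> smooth_funs" "g \<in> smooth_funs"
  shows "Csemi l (\<lambda>x. a * f x + b * g x) \<le> norm a * Csemi l f + norm b * Csemi l g"
proof (rule Csemi_least)
  show "0 \<le> norm a * Csemi l f + norm b * Csemi l g"
    using assms by (simp add: Csemi_nonneg)
  fix i p I assume *: "i \<in> J" "i \<le> l" "p \<in> X closure_of (U i)" "I \<in> multi_indices m" "multi_order m I \<le> l"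
  then have "norm (deriv_at i I (\<lambda>x. a * f x + b * g x) p)
      = norm (a * deriv_at i I f p + b * deriv_at i I g p)"
    using closure_U_subset assms by (subst deriv_at_lincomb) auto
  also have "\<dots> \<le> norm a * norm (deriv_at i I f p) + norm b * norm (deriv_at i I g p)"
    by (metis norm_mult norm_triangle_ineq)
  also have "\<dots> \<le> norm a * Csemi l f + norm b * Csemi l g"
    using * assms by (intro add_mono mult_left_mono Csemi_upper) auto
  finally show "norm (deriv_at i I (\<lambda>x. a * f x + b * g x) p) \<le> norm a * Csemi l f + norm b * Csemi l g" .
qed

lemma zero_in_smooth_funs: "(\<lambda>x. 0 :: 'k::{real_normed_field, euclidean_space}) \<in> smooth_funs"
proof -
  have "smooth_on m (chart_image c) (\<lambda>y. 0 :: 'k)" if "c \<in> A" for c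
    unfolding smooth_on_iff_C_on using C_on_const[OF chart_image_open[OF that]] by blast
  then show ?thesis by (simp add: smooth_functions_def coord_rep_def comp_def)
qed

lemma Csemi_zero: "Csemi l (\<lambda>x. 0 :: 'k::{real_normed_field, euclidean_space}) = 0"
proof (rule antisym)
  show "Csemi l (\<lambda>x. 0 :: 'k) \<le> 0"
    using Csemi_lincomb[OF zero_in_smooth_funs zero_in_smooth_funs, of l "0 :: 'k" 0] by simp
qed (rule Csemi_nonneg[OF zero_in_smooth_funs])

text \<open>
  Only \<open>\<le>\<close> is immediate; the reverse follows by scaling back with \<open>inverse a\<close>.
\<close>

lemma Csemi_scale:
  assumes "f \<in> smooth_funs"
  shows "Csemi l (\<lambda>x. a * f x) = norm a * Csemi l f"
proof (cases "a = 0")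
  case True
  then show ?thesis by (simp add: Csemi_zero)
next
  case False
  have le: "Csemi l (\<lambda>x. b * g x) \<le> norm b * Csemi l g" if "g \<in> smooth_funs" for b g
    using Csemi_lincomb[OF that that, of l b 0] by simp
  have af: "(\<lambda>x. a * f x) \<in> smooth_funs" using smooth_funs_lincomb[OF assms assms, of a 0] by simp
  have "norm a * Csemi l f = norm a * Csemi l (\<lambda>x. inverse a * (a * f x))"
    using False by (simp add: mult.assoc[symmetric])
  also have "\<dots> \<le> norm a * (norm (inverse a) * Csemi l (\<lambda>x. a * f x))"
    using le[OF af] by (intro mult_left_mono) auto
  also have "\<dots> = Csemi l (\<lambda>x. a * f x)"
    using False by (simp add: norm_inverse)
  finally show ?thesis using le[OF assms] by (simp add: antisym)
qed

lemma Csemi_eq_0_imp: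
  assumes "f \<in> smooth_funs" "\<And>l. Csemi l f = 0"
  shows "f = (\<lambda>x. 0)"
proof
  fix x
  show "f x = 0"
  proof (cases "x \<in> topspace X")
    case True
    then obtain i where i: "i \<in> J" "x \<in> U i" using U_covers by blast
    then have "x \<in> X closure_of (U i)" using U_subset_closure by blast
    with i Csemi_upper[OF assms(1), of i i x "\<lambda>_. 0"] assms(2) have "norm (deriv_at i (\<lambda>_. 0) f x) \<le> 0"
      by (simp add: multi_indices_def multi_order_def)
    moreover have "deriv_at i (\<lambda>_. 0) f x = f x"
      using closure_U_subset \<open>x \<in> X closure_of (U i)\<close> i by (intro deriv_at_0) auto
    ultimately show ?thesis by simp
  next
    case False
    then show ?thesis using assms(1) by (simp add: smooth_functions_def)
  qed
qed

end

section \<open>Completeness of the space of smooth functions\<close>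

context covered_manifold
begin

text \<open>
  On each \<open>U i\<close>, read in the chart \<open>\<xi> i\<close>, all derivatives of the sequence are uniformly Cauchy,
  so the pointwise limit is smooth there.  Since the \<open>U i\<close> cover the manifold and transition maps
  are smooth, it is smooth in every chart.  The limit is controlled on \<open>U i\<close> only, while the
  semi-norms take suprema over closures; continuity of the derivatives closes that gap.
\<close>

lemma smooth_funs_complete:
  fixes u :: "nat \<Rightarrow> 'a \<Rightarrow> 'k::{real_normed_field, euclidean_space}"
  assumes u: "\<And>n. u n \<in> smooth_funs"
    and Cau: "\<And>l e. e > 0 \<Longrightarrow> \<exists>N. \<forall>n\<ge>N. \<forall>n'\<ge>N. Csemi l (\<lambda>x. u n x - u n' x) < e"
  shows "\<exists>f\<in>smooth_funs. \<forall>l. (\<lambda>n. Csemi l (\<lambda>x. u n x - f x)) \<longlonglongrightarrow> 0"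
proof -
  have diff: "(\<lambda>x. f x - g x) \<in> smooth_funs" if "f \<in> smooth_funs" "g \<in> smooth_funs" for f g :: "'a \<Rightarrow> 'k"
    using smooth_funs_lincomb[OF that, of 1 "-1"] by simp
  have deriv_diff: "deriv_at i I (\<lambda>x. f x - g x) p = deriv_at i I f p - deriv_at i I g p"
    if "f \<in> smooth_funs" "g \<in> smooth_funs" "i \<in> J" "p \<in> fst (\<xi> i)" for f g :: "'a \<Rightarrow> 'k" and i I p
    using deriv_at_lincomb[OF that, of I 1 "-1"] by simp
  define W where "W i = snd (\<xi> i) ` U i" for i
  have UF: "U i \<subseteq> fst (\<xi> i)" if "i \<in> J" for i
    using U_subset_closure closure_U_subset that by blast
  have W_open: "openin (Euclidean_space m) (W i)" if "i \<in> J" for i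
    unfolding W_def by (rule is_chart_image_open[OF \<xi>_chart U_open UF]) (use that in auto)
  have u_smooth: "smooth_on m (W i) (coord_rep (\<xi> i) (u n))" if "i \<in> J" for i n
    unfolding W_def by (rule smooth_on_subset[OF smooth_funs_smooth_on[OF u that]]) (use UF that in blast)
  have Cau_W: "uniformly_Cauchy_on (W i) (\<lambda>n. iter_partial_deriv js (coord_rep (\<xi> i) (u n)))"
    if "i \<in> J" and js: "set js \<subseteq> {..<m}" for i js
    unfolding uniformly_Cauchy_on_def
  proof (intro allI impI)
    fix e :: real assume "e > 0"
    define I where "I = count_list js"
    have I: "I \<in> multi_indices m"
      using js unfolding I_def multi_indices_def by (force simp: count_list_0_iff)
    \<comment> \<open>A semi-norm of index at least \<open>i\<close> sees \<open>U i\<close>, one of index at least the order of \<open>I\<close>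
      sees the derivative.\<close>
    obtain N where N: "\<And>n n'. n \<ge> N \<Longrightarrow> n' \<ge> N \<Longrightarrow>
        Csemi (max i (multi_order m I)) (\<lambda>x. u n x - u n' x) < e"
      using Cau[OF \<open>e > 0\<close>] by meson
    have "dist (iter_partial_deriv js (coord_rep (\<xi> i) (u n)) y)
        (iter_partial_deriv js (coord_rep (\<xi> i) (u n')) y) < e"
      if y: "y \<in> W i" and n: "n \<ge> N" "n' \<ge> N" for y n n'
    proof -
      obtain p where p: "p \<in> U i" "y = snd (\<xi> i) p" using y by (auto simp: W_def)
      have eq: "iter_partial_deriv js (coord_rep (\<xi> i) (u n)) y = deriv_at i I (u n) p" for n
        using iter_partial_deriv_eq_multi_deriv[OF W_open u_smooth js y] \<open>i \<in> J\<close>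
        by (simp add: p(2) deriv_at_def I_def)
      have "norm (deriv_at i I (\<lambda>x. u n x - u n' x) p) \<le> Csemi (max i (multi_order m I)) (\<lambda>x. u n x - u n' x)"
        using p(1) U_subset_closure \<open>i \<in> J\<close> I by (intro Csemi_upper diff u) auto
      also have "\<dots> < e" using N n by blast
      finally show ?thesis
        unfolding eq dist_norm using deriv_diff[OF u u \<open>i \<in> J\<close>] p(1) UF[OF \<open>i \<in> J\<close>] by auto
    qed
    then show "\<exists>M. \<forall>x\<in>W i. \<forall>n\<ge>M. \<forall>n'\<ge>M.
        dist (iter_partial_deriv js (coord_rep (\<xi> i) (u n)) x)
          (iter_partial_deriv js (coord_rep (\<xi> i) (u n')) x) < e"
      by blast
  qed
  define f where "f x = lim (\<lambda>n. u n x)" for x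
  have f_out: "f x = 0" if "x \<notin> topspace X" for x
    using u that unfolding f_def smooth_functions_def by simp
  have f_lim: "(\<lambda>n. coord_rep (\<xi> i) (u n) y) \<longlonglongrightarrow> coord_rep (\<xi> i) f y" if "i \<in> J" "y \<in> W i" for i y
  proof -
    obtain p where p: "p \<in> U i" "y = snd (\<xi> i) p" using \<open>y \<in> W i\<close> by (auto simp: W_def)
    have "uniformly_convergent_on (W i) (\<lambda>n. coord_rep (\<xi> i) (u n))"
      using Cau_W[of i "[]"] that by (auto intro: Cauchy_uniformly_convergent)
    then have "convergent (\<lambda>n. coord_rep (\<xi> i) (u n) y)"
      using that(2) by (rule uniformly_convergent_imp_convergent)
    moreover have "coord_rep (\<xi> i) g y = g p" for g :: "'a \<Rightarrow> 'k"
      using coord_rep_chart[OF \<xi>_chart] p UF that by blast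
    ultimately show ?thesis unfolding f_def by (simp add: convergent_LIMSEQ_iff)
  qed
  have f_smooth: "smooth_on m (W i) (coord_rep (\<xi> i) f)"
    and f_derivs: "\<And>js y. set js \<subseteq> {..<m} \<Longrightarrow> y \<in> W i \<Longrightarrow>
      (\<lambda>n. iter_partial_deriv js (coord_rep (\<xi> i) (u n)) y) \<longlonglongrightarrow> iter_partial_deriv js (coord_rep (\<xi> i) f) y"
    if "i \<in> J" for i
    by (rule smooth_on_limit[OF W_open[OF that] u_smooth[OF that] f_lim[OF that] Cau_W[OF that]]; assumption)+
  have "f \<in> smooth_funs"
    unfolding smooth_functions_def
  proof (intro CollectI conjI allI impI ballI f_out)
    fix c assume "c \<in> A"
    note c = chart[OF this]
    show "smooth_on m (chart_image c) (coord_rep c f)"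
    proof (rule smooth_on_open_cover)
      show "chart_image c \<subseteq> topspace (Euclidean_space m)"
        using chart_image_open[OF \<open>c \<in> A\<close>] by (rule openin_subset)
      fix y assume "y \<in> chart_image c"
      then obtain p where p: "p \<in> fst c" "y = snd c p" by blast
      then have "p \<in> topspace X" using c unfolding is_chart_def by (meson openin_subset subsetD)
      then obtain i where i: "i \<in> J" "p \<in> U i" using U_covers by blast
      define R where "R = snd c ` (fst c \<inter> U i)"
      define T where "T y = snd (\<xi> i) (inv_into (fst c) (snd c) y)" for y
      have inv: "inv_into (fst c) (snd c) (snd c q) = q" if "q \<in> fst c" for q
        using is_chart_inj_on[OF c] that by simp
      have R: "openin (Euclidean_space m) R"
        unfolding R_def
        using c U_open[OF i(1)] by (intro is_chart_image_open[OF c]) (auto simp: is_chart_def)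
      have "smooth_on m R (\<lambda>y. coord_rep (\<xi> i) f (T y))"
      proof (rule smooth_on_compose[OF W_open f_smooth R])
        show "T ` R \<subseteq> W i" by (auto simp: R_def T_def W_def inv)
        fix k assume "k < m"
        have "smooth_transition m c (\<xi> i)"
          using manifold \<open>c \<in> A\<close> \<xi>_in_atlas[OF i(1)]
          unfolding smooth_manifold_def compatible_charts_def by blast
        with \<open>k < m\<close> have "smooth_on m (snd c ` (fst c \<inter> fst (\<xi> i))) (coord_rep c (\<lambda>q. snd (\<xi> i) q k))"
          unfolding smooth_transition_def by blast
        then show "smooth_on m R (\<lambda>y. T y k)"
          using UF[OF i(1)] unfolding T_def coord_rep_def comp_def
          by (elim smooth_on_subset) (auto simp: R_def)
      qed (rule i)+
      then have "smooth_on m R (coord_rep c f)"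
      proof (rule smooth_on_cong[OF R])
        fix y assume "y \<in> R"
        then obtain q where q: "q \<in> fst c" "q \<in> U i" "y = snd c q" by (auto simp: R_def)
        then show "coord_rep (\<xi> i) f (T y) = coord_rep c f y"
          using coord_rep_chart[OF c q(1), of f] coord_rep_chart[OF \<xi>_chart[OF i(1)], of q f] UF[OF i(1)]
          by (auto simp: T_def inv)
      qed
      with R p i show "\<exists>R. openin (Euclidean_space m) R \<and> y \<in> R \<and> R \<subseteq> chart_image c \<and> smooth_on m R (coord_rep c f)"
        by (intro exI[of _ R]) (auto simp: R_def)
    qed
  qed
  moreover have "(\<lambda>n. Csemi l (\<lambda>x. u n x - f x)) \<longlonglongrightarrow> 0" for l
  proof (rule LIMSEQ_I)
    fix e :: real assume "e > 0"
    then obtain N where N: "\<And>n n'. n \<ge> N \<Longrightarrow> n' \<ge> N \<Longrightarrow> Csemi l (\<lambda>x. u n x - u n' x) < e / 2"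
      using Cau[of "e / 2" l] by (meson half_gt_zero)
    have "Csemi l (\<lambda>x. u n x - f x) \<le> e / 2" if "n \<ge> N" for n
    proof (rule Csemi_least)
      fix i p I assume *: "i \<in> J" "i \<le> l" "p \<in> X closure_of (U i)" "I \<in> multi_indices m" "multi_order m I \<le> l"
      have on_U: "norm (deriv_at i I (\<lambda>x. u n x - f x) q) \<le> e / 2" if "q \<in> U i" for q
      proof (rule LIMSEQ_le_const2)
        have q: "q \<in> fst (\<xi> i)" "q \<in> X closure_of (U i)" "snd (\<xi> i) q \<in> W i"
          using that UF U_subset_closure *(1) by (auto simp: W_def)
        have "(\<lambda>n'. deriv_at i I (u n') q) \<longlonglongrightarrow> deriv_at i I f q"
          unfolding deriv_at_def multi_deriv_def
          by (rule f_derivs[OF *(1) set_multi_word q(3)])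
        then show "(\<lambda>n'. norm (deriv_at i I (u n) q - deriv_at i I (u n') q))
            \<longlonglongrightarrow> norm (deriv_at i I (\<lambda>x. u n x - f x) q)"
          unfolding deriv_diff[OF u \<open>f \<in> smooth_funs\<close> *(1) q(1)] by (intro tendsto_intros)
        show "\<exists>M. \<forall>n'\<ge>M. norm (deriv_at i I (u n) q - deriv_at i I (u n') q) \<le> e / 2"
        proof (intro exI allI impI)
          fix n' assume "n' \<ge> N"
          have "norm (deriv_at i I (\<lambda>x. u n x - u n' x) q) \<le> Csemi l (\<lambda>x. u n x - u n' x)"
            using * q(2) by (intro Csemi_upper diff u)
          then show "norm (deriv_at i I (u n) q - deriv_at i I (u n') q) \<le> e / 2"
            using N[OF \<open>n \<ge> N\<close> \<open>n' \<ge> N\<close>] deriv_diff[OF u u *(1) q(1)] by simp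
        qed
      qed
      show "norm (deriv_at i I (\<lambda>x. u n x - f x) p) \<le> e / 2"
      proof (rule closure_of_bound[where h = "\<lambda>p. norm (deriv_at i I (\<lambda>x. u n x - f x) p)"])
        show "openin X (fst (\<xi> i))" using \<xi>_chart[OF *(1)] by (simp add: is_chart_def)
        show "continuous_map (subtopology X (fst (\<xi> i))) euclidean
            (\<lambda>p. norm (deriv_at i I (\<lambda>x. u n x - f x) p))"
          by (rule deriv_at_continuous[OF diff[OF u \<open>f \<in> smooth_funs\<close>] *(1)])
      qed (use on_U * closure_U_subset in auto)
    qed (use \<open>e > 0\<close> in simp)
    then show "\<exists>N. \<forall>n\<ge>N. norm (Csemi l (\<lambda>x. u n x - f x) - 0) < e"
      using Csemi_nonneg[OF diff[OF u \<open>f \<in> smooth_funs\<close>]] \<open>e > 0\<close> by (intro exI[of _ N]) fastforce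
  qed
  ultimately show ?thesis by blast
qed

end

section \<open>The metric of a Frechet space\<close>

lemma frechet_spaceD:
  assumes "frechet_space smul V p"
  shows "vector_space smul" "module.subspace smul V" "seminorm_on smul V (p k)"
    "x \<in> V \<Longrightarrow> (\<And>k. p k x = 0) \<Longrightarrow> x = 0"
  using assms by (simp_all add: frechet_space_def)

lemma seminorm_onD:
  assumes "seminorm_on smul V q" "x \<in> V"
  shows "0 \<le> q x" "y \<in> V \<Longrightarrow> q (x + y) \<le> q x + q y" "q (smul a x) = norm a * q x"
  using assms by (simp_all add: seminorm_on_def)

lemma frechet_space_diff_closed:
  assumes "frechet_space smul V p" "x \<in> V" "y \<in> V"
  shows "x - y \<in> V"
proof -
  interpret vector_space smul by (rule frechet_spaceD[OF assms(1)])
  show ?thesis by (rule subspace_diff[OF frechet_spaceD(2)[OF assms(1)] assms(2,3)])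
qed

lemma frechet_space_seminorm_minus:
  assumes "frechet_space smul V p" "x \<in> V"
  shows "p k (- x) = p k x"
proof -
  interpret vector_space smul by (rule frechet_spaceD[OF assms(1)])
  show ?thesis
    using seminorm_onD(3)[OF frechet_spaceD(3)[OF assms(1)] assms(2), of k "- 1"] by simp
qed

text \<open>
  The map \<open>t \<mapsto> t / (1 + t)\<close> is increasing and subadditive; this gives the triangle inequality
  termwise.
\<close>

lemma frechet_term_subadditive:
  fixes a b c :: real
  assumes "0 \<le> a" "0 \<le> b" "0 \<le> c" "c \<le> a + b"
  shows "c / (1 + c) \<le> a / (1 + a) + b / (1 + b)"
proof -
  have "c / (1 + c) = 1 - 1 / (1 + c)" using assms by (simp add: field_simps)
  also have "\<dots> \<le> 1 - 1 / (1 + (a + b))" using assms by (intro diff_left_mono divide_left_mono) auto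
  also have "\<dots> = a / (1 + (a + b)) + b / (1 + (a + b))"
    using assms by (simp add: add_divide_distrib[symmetric] divide_simps)
  also have "\<dots> \<le> a / (1 + a) + b / (1 + b)"
    using assms by (intro add_mono divide_left_mono) auto
  finally show ?thesis .
qed

lemma frechet_space_imp_Metric_space:
  assumes F: "frechet_space smul V p"
  shows "Metric_space V (frechet_dist V p)"
proof -
  define summand where "summand k x y = (1 / 2) ^ k * (p k (x - y) / (1 + p k (x - y)))" for k x y
  have dist_eq: "frechet_dist V p x y = (if x \<in> V \<and> y \<in> V then \<Sum>k. summand k x y else 0)" for x y
    by (simp add: frechet_dist_def summand_def)
  have nonneg: "0 \<le> p k (x - y)" if "x \<in> V" "y \<in> V" for k x y
    by (rule seminorm_onD(1)[OF frechet_spaceD(3)[OF F] frechet_space_diff_closed[OF F that]])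
  have t0: "0 \<le> summand k x y" if "x \<in> V" "y \<in> V" for k x y
    unfolding summand_def using nonneg[OF that] by (intro mult_nonneg_nonneg divide_nonneg_nonneg) auto
  have t1: "summand k x y \<le> (1 / 2) ^ k" if "x \<in> V" "y \<in> V" for k x y
    unfolding summand_def using nonneg[OF that, of k] by (intro mult_left_le) (auto simp: field_simps)
  have sum: "summable (\<lambda>k. summand k x y)" if "x \<in> V" "y \<in> V" for x y
    by (rule summable_comparison_test'[OF summable_geometric[of "1 / 2 :: real"]])
      (use t0 t1 that in auto)
  have sym: "p k (x - y) = p k (y - x)" if "x \<in> V" "y \<in> V" for k x y
    using frechet_space_seminorm_minus[OF F frechet_space_diff_closed[OF F that], of k] by simp
  show ?thesis
  proof
    show "0 \<le> frechet_dist V p x y" for x y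
      unfolding dist_eq using t0 sum by (auto intro: suminf_nonneg)
    show "frechet_dist V p x y = frechet_dist V p y x" for x y
    proof -
      have "summand k x y = summand k y x" if "x \<in> V" "y \<in> V" for k
        unfolding summand_def using sym[OF that] by simp
      then show ?thesis unfolding dist_eq by auto
    qed
    fix x y assume xy: "x \<in> V" "y \<in> V"
    show "frechet_dist V p x y = 0 \<longleftrightarrow> x = y"
    proof -
      have "frechet_dist V p x y = 0 \<longleftrightarrow> (\<forall>k. summand k x y = 0)"
        unfolding dist_eq using suminf_eq_zero_iff[OF sum[OF xy] t0[OF xy]] xy by simp
      also have "\<dots> \<longleftrightarrow> (\<forall>k. p k (x - y) = 0)"
        unfolding summand_def using nonneg[OF xy] by (simp add: add_nonneg_eq_0_iff)
      also have "\<dots> \<longleftrightarrow> x = y"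
      proof
        assume "\<forall>k. p k (x - y) = 0"
        then have "x - y = 0"
          using frechet_spaceD(4)[OF F frechet_space_diff_closed[OF F xy]] by blast
        then show "x = y" by simp
      next
        assume "x = y"
        interpret vector_space smul by (rule frechet_spaceD[OF F])
        show "\<forall>k. p k (x - y) = 0"
          using seminorm_onD(3)[OF frechet_spaceD(3)[OF F] frechet_space_diff_closed[OF F xy], of _ 0]
            \<open>x = y\<close> by simp
      qed
      finally show ?thesis .
    qed
    fix z assume z: "z \<in> V"
    have "summand k x z \<le> summand k x y + summand k y z" for k
    proof -
      have "p k ((x - y) + (y - z)) \<le> p k (x - y) + p k (y - z)"
        by (rule seminorm_onD(2)[OF frechet_spaceD(3)[OF F] frechet_space_diff_closed[OF F xy]
              frechet_space_diff_closed[OF F xy(2) z]])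
      then have "p k (x - z) / (1 + p k (x - z)) \<le>
          p k (x - y) / (1 + p k (x - y)) + p k (y - z) / (1 + p k (y - z))"
        using nonneg xy z by (intro frechet_term_subadditive) auto
      from mult_left_mono[OF this, of "(1 / 2) ^ k"] show ?thesis
        by (simp add: summand_def distrib_left)
    qed
    then have "(\<Sum>k. summand k x z) \<le> (\<Sum>k. summand k x y + summand k y z)"
      by (rule suminf_le) (intro sum summable_add xy z)+
    then show "frechet_dist V p x z \<le> frechet_dist V p x y + frechet_dist V p y z"
      unfolding dist_eq using xy z by (simp add: suminf_add[OF sum sum])
  qed
qed

section \<open>Formal power series of smooth functions\<close>

lemma vector_space_hbar_scale: "vector_space hbar_scale"
  by unfold_locales (auto simp: hbar_scale_def fps_eq_iff fun_eq_iff algebra_simps)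

context covered_manifold
begin

abbreviation hsemi :: "nat \<Rightarrow> ('a \<Rightarrow> 'k::{real_normed_field, euclidean_space}) fps \<Rightarrow> real" where
  "hsemi \<equiv> hbar_seminorm X m J U \<xi>"

abbreviation hseries :: "('a \<Rightarrow> 'k::{real_normed_field, euclidean_space}) fps set" where
  "hseries \<equiv> hbar_series X m A"

lemma hseries_nth: "F \<in> hseries \<Longrightarrow> fps_nth F i \<in> smooth_funs"
  by (simp add: hbar_series_def)

lemma hsemi_eq: "hsemi k F = (\<Sum>i\<le>k. Csemi (k - i) (fps_nth F i))"
proof -
  have "(\<Sum>(i, j) | i + j = k. Csemi j (fps_nth F i)) = (\<Sum>i\<le>k. Csemi (k - i) (fps_nth F i))"
    by (rule sum.reindex_bij_witness[where i = "\<lambda>i. (i, k - i)" and j = fst]) auto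
  then show ?thesis by (simp add: hbar_seminorm_def)
qed

text \<open>
  Each coefficient is controlled by a single semi-norm of the series, which transports the Cauchy
  property to coefficients.
\<close>

lemma hsemi_upper:
  assumes "F \<in> hseries"
  shows "Csemi l (fps_nth F i) \<le> hsemi (i + l) F"
proof -
  have "Csemi (i + l - i) (fps_nth F i) \<le> hsemi (i + l) F"
    unfolding hsemi_eq by (rule member_le_sum) (auto intro: Csemi_nonneg hseries_nth[OF assms])
  then show ?thesis by simp
qed

lemma seminorm_on_hsemi: "seminorm_on hbar_scale hseries (hsemi k)"
  unfolding seminorm_on_def
proof (intro conjI ballI allI)
  fix F :: "('a \<Rightarrow> 'b) fps" assume F: "F \<in> hseries"
  show "0 \<le> hsemi k F"
    unfolding hsemi_eq by (intro sum_nonneg Csemi_nonneg hseries_nth F)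
  show "hsemi k (hbar_scale a F) = norm a * hsemi k F" for a
    unfolding hsemi_eq by (simp add: hbar_scale_def Csemi_scale hseries_nth[OF F] sum_distrib_left)
  fix G :: "('a \<Rightarrow> 'b) fps" assume G: "G \<in> hseries"
  have "Csemi j (fps_nth (F + G) i) \<le> Csemi j (fps_nth F i) + Csemi j (fps_nth G i)" for i j
    using Csemi_lincomb[OF hseries_nth[OF F, of i] hseries_nth[OF G, of i], of j 1 1]
    by (simp add: plus_fun_def)
  then show "hsemi k (F + G) \<le> hsemi k F + hsemi k G"
    unfolding hsemi_eq sum.distrib[symmetric] by (intro sum_mono)
qed

lemma subspace_hseries: "module.subspace hbar_scale hseries"
proof -
  interpret vector_space "hbar_scale :: 'b \<Rightarrow> ('a \<Rightarrow> 'b) fps \<Rightarrow> _" by (rule vector_space_hbar_scale)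
  show ?thesis
  proof (rule subspaceI)
    show "0 \<in> hseries" using zero_in_smooth_funs by (simp add: hbar_series_def zero_fun_def)
    fix F G :: "('a \<Rightarrow> 'b) fps" assume F: "F \<in> hseries"
    show "hbar_scale a F \<in> hseries" for a
      using smooth_funs_lincomb[OF hseries_nth[OF F] hseries_nth[OF F], of a _ 0] by (simp add: hbar_series_def hbar_scale_def)
    assume G: "G \<in> hseries"
    show "F + G \<in> hseries"
      using smooth_funs_lincomb[OF hseries_nth[OF F] hseries_nth[OF G], of 1 _ 1] by (simp add: hbar_series_def plus_fun_def)
  qed
qed

text \<open>
  Coefficientwise limits suffice, because each semi-norm is a finite sum of semi-norms of
  coefficients.
\<close>

lemma hseries_complete:
  fixes s :: "nat \<Rightarrow> ('a \<Rightarrow> 'k::{real_normed_field, euclidean_space}) fps"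
  assumes s: "\<And>n. s n \<in> hseries"
    and Cau: "\<And>k e. e > 0 \<Longrightarrow> \<exists>N. \<forall>n\<ge>N. \<forall>n'\<ge>N. hsemi k (s n - s n') < e"
  shows "\<exists>F\<in>hseries. \<forall>k. (\<lambda>n. hsemi k (s n - F)) \<longlonglongrightarrow> 0"
proof -
  interpret vector_space "hbar_scale :: 'k \<Rightarrow> ('a \<Rightarrow> 'k) fps \<Rightarrow> _" by (rule vector_space_hbar_scale)
  have nth_diff: "fps_nth (F - G) i = (\<lambda>x. fps_nth F i x - fps_nth G i x)" for F G :: "('a \<Rightarrow> 'k) fps" and i
    by (simp add: fun_eq_iff fun_diff_def)
  have "\<exists>f\<in>smooth_funs. \<forall>l. (\<lambda>n. Csemi l (\<lambda>x. fps_nth (s n) i x - f x)) \<longlonglongrightarrow> 0" for i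
  proof (rule smooth_funs_complete)
    show "fps_nth (s n) i \<in> smooth_funs" for n using s by (rule hseries_nth)
    fix l and e :: real assume "e > 0"
    then obtain N where N: "\<And>n n'. n \<ge> N \<Longrightarrow> n' \<ge> N \<Longrightarrow> hsemi (i + l) (s n - s n') < e"
      using Cau by meson
    have "Csemi l (\<lambda>x. fps_nth (s n) i x - fps_nth (s n') i x) < e" if "n \<ge> N" "n' \<ge> N" for n n'
      using hsemi_upper[OF subspace_diff[OF subspace_hseries s s], of l n n' i] N[OF that]
      unfolding nth_diff by linarith
    then show "\<exists>N. \<forall>n\<ge>N. \<forall>n'\<ge>N. Csemi l (\<lambda>x. fps_nth (s n) i x - fps_nth (s n') i x) < e" by blast
  qed
  then have "\<exists>f. \<forall>i. f i \<in> smooth_funs \<and> (\<forall>l. (\<lambda>n. Csemi l (\<lambda>x. fps_nth (s n) i x - f i x)) \<longlonglongrightarrow> 0)"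
    by (intro choice) blast
  then obtain f where f: "\<And>i. f i \<in> smooth_funs"
    "\<And>i l. (\<lambda>n. Csemi l (\<lambda>x. fps_nth (s n) i x - f i x)) \<longlonglongrightarrow> 0"
    by blast
  have "(\<lambda>n. hsemi k (s n - Abs_fps f)) \<longlonglongrightarrow> 0" for k
    unfolding hsemi_eq nth_diff fps_nth_Abs_fps by (intro tendsto_null_sum f(2))
  moreover have "Abs_fps f \<in> hseries" using f(1) by (simp add: hbar_series_def)
  ultimately show ?thesis by blast
qed

theorem frechet_space_hseries:
  "frechet_space (hbar_scale :: 'k::{real_normed_field, euclidean_space} \<Rightarrow> ('a \<Rightarrow> 'k) fps \<Rightarrow> _) hseries hsemi"
  unfolding frechet_space_def
proof (intro conjI allI ballI impI)
  fix F :: "('a \<Rightarrow> 'k) fps" assume F: "F \<in> hseries" and hsemi0: "\<forall>k. hsemi k F = 0"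
  have "Csemi l (fps_nth F i) = 0" for l i
    using hsemi_upper[OF F, of l i] hsemi0 Csemi_nonneg[OF hseries_nth[OF F], of l i] by simp
  then show "F = 0"
    using Csemi_eq_0_imp[OF hseries_nth[OF F]] by (simp add: fps_eq_iff zero_fun_def)
qed (use hseries_complete vector_space_hbar_scale subspace_hseries seminorm_on_hsemi in blast)+

end

theorem lemma2p16:
  fixes X :: "'a topology" and m :: nat and A :: "'a chart set" and \<omega> :: "'a form2"
    and J :: "nat set" and U :: "nat \<Rightarrow> 'a set" and \<xi> :: "nat \<Rightarrow> 'a chart"
    and V :: "('a \<Rightarrow> 'k::{real_normed_field, euclidean_space}) fps set"
  assumes "symplectic_manifold X m A \<omega>"
    and "admissible_covering X A J U \<xi>"
    and "V = hbar_series X m A"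
  shows "frechet_space hbar_scale V (hbar_seminorm X m J U \<xi>) \<and>
         Metric_space V (frechet_dist V (hbar_seminorm X m J U \<xi>))"
proof -
  interpret covered_manifold X m A J U \<xi>
    using assms(1,2) by unfold_locales (simp_all add: symplectic_manifold_def)
  show ?thesis
    unfolding assms(3) using frechet_space_hseries frechet_space_imp_Metric_space by blast
qed

end
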